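(* Let $\mathcal F$ and $\mathcal G$ be finite sets with $|\mathcal F|=m$ and $|\mathcal G|=n$, let $f\mapsto -f$ be an involution on $\mathcal F$, and let $\mathbb F$ be a field. Let $tv_{m,n}(\cdot)$ be the ideal Turaev--Viro invariant of type $(m,n)$ for these data, obtained from the Turaev--Viro ideal $I_{m,n}\subset R$, and let $\widehat{tv}_{m,n}(\cdot)$ be the associated universal numerical Turaev--Viro invariant. Then for all compact $3$-manifolds $M_1,M_2$, $$\widehat{tv}_{m,n}(M_1)=\widehat{tv}_{m,n}(M_2)$$ if and only if all numerical Turaev--Viro invariants associated to $tv_{m,n}(\cdot)$ coincide on $M_1$ and $M_2$.
   Context: **Special spines.** A simple $2$-polyhedron $P$ is a compact connected Hausdorff space in which every point has an open neighbourhood of one of three types (the point corresponding to the distinguished point): (i) an open disc (distinguished point: its centre); (ii) $\mathbb R\times Y$, i.e. three half-planes glued along their common boundary line (distinguished point on the line); (iii) the open cone over the complete graph $K_4$ (distinguished point: the cone point). The connected components of the set of points of type (i) are the $2$-strata, those of type (ii) the true edges, and the points of type (iii) are the true vertices; $\mathcal C(P),\mathcal E(P),\mathcal V(P)$ denote the sets of $2$-strata, true edges, true vertices. The singular graph $S(P)$ is the union of true edges and true vertices. $P$ is a special $2$-polyhedron if it has a true vertex, $S(P)$ is connected, and all $2$-strata are homeomorphic to open discs. A special $2$-polyhedron $P$ embedded in a compact $3$-manifold $M$ is a special spine of $M$ if either $\partial M=\emptyset$ and $M\setminus P$ is homeomorphic to an open $3$-ball, or $\partial M\neq\emptyset$ and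 $M\setminus P\approx(\partial M)\times[0,1)$. Compact $3$-manifolds are understood to be connected; each of them has special spines with at least two true vertices. **Symbols and the ring $R$.** To each $f\in\mathcal F$ associate a symbol $w(f)$ (colour weight), and to all $a,\dots,f\in\mathcal F$, $A,\dots,D\in\mathcal G$ a symbol $\left|\begin{smallmatrix} a&b&c\\ f&e&d\end{smallmatrix}\right|^{A,B}_{C,D}$ ($6j4k$-symbol). Symbols are identified according to the equivalence relation generated by $w(f)=w(-f)$ and $$\left|\begin{smallmatrix} a&b&c\\ f&e&d\end{smallmatrix}\right|^{A,B}_{C,D}=\left|\begin{smallmatrix} b&c&a\\ -e&-d&f\end{smallmatrix}\right|^{C,A}_{B,D}=\left|\begin{smallmatrix} a&-d&-e\\ -f&-c&-b\end{smallmatrix}\right|^{A,B}_{D,C}.$$ $R$ is the polynomial ring over $\mathbb F$ whose variables are the equivalence classes of colour weights and $6j4k$-symbols; $N$ is the number of its variables. **Colourings and state sum.** Let $P$ be a special $2$-polyhedron; choose an orientation of each $2$-stratum. An $\mathcal F,\mathcal G$-colouring is a pair $(\varphi,\psi)$ of maps $\varphi:\mathcal C(P)\to\mathcal F$, $\psi:\mathcal E(P)\to\mathcal G$; $\Phi_{\mathcal F,\mathcal G}(P)$ is the set of all of them. A $2$-stratum with its chosen orientation has colour $\varphi(C)$, with the opposite orientation it has colour $-\varphi(C)$. At a true vertex $v$ four germs of true edges meet; label them $g_A,g_B,g_C,g_D$ in any way. Each pair of germs bounds exactly one sector of a $2$-stratum at $v$. For germs $x\ne y$ let $(x\to y)$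 denote the sector between $x$ and $y$, oriented so that the oriented boundary of the $2$-stratum reaches $v$ along $x$ and leaves $v$ along $y$. Let $A,B,C,D\in\mathcal G$ be the colours of $g_A,g_B,g_C,g_D$, and let $a,b,c,d,e,f\in\mathcal F$ be the colours of the oriented sectors $(g_A\to g_B)$, $(g_C\to g_A)$, $(g_B\to g_C)$, $(g_A\to g_D)$, $(g_D\to g_B)$, $(g_C\to g_D)$, respectively. Then $v^{\varphi,\psi}=\left|\begin{smallmatrix} a&b&c\\ f&e&d\end{smallmatrix}\right|^{A,B}_{C,D}\in R$; by the symmetries this does not depend on the labelling of germs. The Turaev--Viro state sum of type $(m,n)$ is $$TV_{m,n}(P)=\sum_{(\varphi,\psi)\in\Phi_{\mathcal F,\mathcal G}(P)}\Bigl(\prod_{C\in\mathcal C(P)}w(\varphi(C))\Bigr)\cdot\Bigl(\prod_{v\in\mathcal V(P)}v^{\varphi,\psi}\Bigr)\in R,$$ which is independent of the choice of orientations of the $2$-strata. **Turaev--Viro ideal.** $I_{m,n}\subset R$ is the ideal generated by the polynomials $$\sum_{A\in\mathcal G}\left|\begin{smallmatrix} j_1&j_2&j_3\\ j_9&j_8&j_7\end{smallmatrix}\right|^{k_1,k_2}_{k_3,A}\left|\begin{smallmatrix} j_4&j_5&j_6\\ -j_9&-j_8&-j_7\end{smallmatrix}\right|^{k_4,k_5}_{k_6,A}-\sum_{A_1,A_2,A_3\in\mathcal G}\sum_{j\in\mathcal F}w(j)\left|\begin{smallmatrix} j&j_1&j_2\\ j_7&-j_5&-j_4\end{smallmatrix}\right|^{A_1,A_2}_{k_1,k_4}\left|\begin{smallmatrix}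 j&j_2&j_3\\ j_9&-j_6&-j_5\end{smallmatrix}\right|^{A_2,A_3}_{k_3,k_6}\left|\begin{smallmatrix} j&j_3&j_1\\ -j_8&-j_4&-j_6\end{smallmatrix}\right|^{A_3,A_1}_{k_2,k_5}$$ for all $j_1,\dots,j_9\in\mathcal F$ and $k_1,\dots,k_6\in\mathcal G$. **Invariants.** For a compact $3$-manifold $M$ with a special spine $P$ having at least two true vertices: - the ideal Turaev--Viro invariant is $tv_{m,n}(M)=TV_{m,n}(P)+I_{m,n}\in R/I_{m,n}$; it depends only on the homeomorphism type of $M$, not on $P$; - the universal numerical Turaev--Viro invariant associated to $tv_{m,n}$ is $\widehat{tv}_{m,n}(M)=TV_{m,n}(P)+\sqrt{I_{m,n}}\in R/\sqrt{I_{m,n}}$, where $\sqrt{I_{m,n}}$ is the radical of $I_{m,n}$; - let $\hat{\mathbb F}$ be the algebraic closure of $\mathbb F$ and $\mathfrak v(I_{m,n})\subset\hat{\mathbb F}^N$ the affine zero variety of $I_{m,n}$. For each $x\in\mathfrak v(I_{m,n})$, the assignment $M\mapsto TV_{m,n}(P)(x)\in\hat{\mathbb F}$ (evaluation of the state sum at $x$) does not depend on the choice of $P$ and is called a numerical Turaev--Viro invariant associated to $tv_{m,n}(\cdot)$. *)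

theory Defs
  imports
    "HOL-Complex_Analysis.Winding_Numbers"
    "HOL-Algebra.Algebraic_Closure_Type"
    "HOL-Library.Poly_Mapping"
begin

section \<open>Special polyhedra and special spines\<close>

text \<open>Some point of \<open>D\<close> in the model \<open>Q\<close> corresponds to \<open>x\<close> under a homeomorphism of \<open>Q\<close>
  onto an open neighbourhood of \<open>x\<close> in \<open>P\<close>.\<close>

definition modelled_on :: "'a topology \<Rightarrow> 'b::topological_space set \<Rightarrow> 'b set \<Rightarrow> 'a \<Rightarrow> bool" where
  "modelled_on P Q D x \<longleftrightarrow>
     (\<exists>k. embedding_map (top_of_set Q) P k \<and> openin P (k ` Q) \<and> (\<exists>p\<in>D \<inter> Q. k p = x))"

abbreviation open_disc :: "complex set" where
  "open_disc \<equiv> ball 0 1"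

definition tripod :: "(real^3) set" where
  "tripod = {axis i t | i t. 0 \<le> t}"

definition K4 :: "(real^4) set" where
  "K4 = (\<Union>i j. closed_segment (axis i 1) (axis j 1))"

text \<open>\<open>K4\<close> lies in a hyperplane missing the origin, so this is a copy of the abstract open cone.\<close>

definition cone_K4 :: "(real^4) set" where
  "cone_K4 = {t *\<^sub>R x | t x. 0 \<le> t \<and> t < 1 \<and> x \<in> K4}"

definition surface_points :: "'a topology \<Rightarrow> 'a set" where
  "surface_points P = {x. modelled_on P open_disc {0} x}"

definition triple_points :: "'a topology \<Rightarrow> 'a set" where
  "triple_points P = {x. modelled_on P ((UNIV :: real set) \<times> tripod) (UNIV \<times> {0}) x}"

definition true_vertices :: "'a topology \<Rightarrow> 'a set" where
  "true_vertices P = {x. modelled_on P cone_K4 {0} x}"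

definition strata :: "'a topology \<Rightarrow> 'a set set" where
  "strata P = connected_components_of (subtopology P (surface_points P))"

definition true_edges :: "'a topology \<Rightarrow> 'a set set" where
  "true_edges P = connected_components_of (subtopology P (triple_points P))"

definition singular_graph :: "'a topology \<Rightarrow> 'a set" where
  "singular_graph P = \<Union>(true_edges P) \<union> true_vertices P"

definition simple_polyhedron :: "'a topology \<Rightarrow> bool" where
  "simple_polyhedron P \<longleftrightarrow> compact_space P \<and> connected_space P \<and> Hausdorff_space P \<and>
     topspace P = surface_points P \<union> triple_points P \<union> true_vertices P"

definition special_polyhedron :: "'a topology \<Rightarrow> bool" where
  "special_polyhedron P \<longleftrightarrow> simple_polyhedron P \<and> true_vertices P \<noteq> {} \<and>
     connectedin P (singular_graph P) \<and>
     (\<forall>C\<in>strata P. subtopology P C homeomorphic_space top_of_set open_disc)"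

definition half_space :: "(real^3) set" where
  "half_space = {v. 0 \<le> v $ 1}"

definition manifold_interior :: "'a topology \<Rightarrow> 'a set" where
  "manifold_interior M = {x. modelled_on M (UNIV :: (real^3) set) UNIV x}"

definition manifold_boundary :: "'a topology \<Rightarrow> 'a set" where
  "manifold_boundary M = topspace M - manifold_interior M"

definition compact_3_manifold :: "'a topology \<Rightarrow> bool" where
  "compact_3_manifold M \<longleftrightarrow> topspace M \<noteq> {} \<and>
     compact_space M \<and> connected_space M \<and> Hausdorff_space M \<and>
     (\<forall>x\<in>topspace M. modelled_on M (UNIV :: (real^3) set) UNIV x \<or> modelled_on M half_space UNIV x)"

definition special_spine :: "'a topology \<Rightarrow> 'a set \<Rightarrow> bool" where
  "special_spine M S \<longleftrightarrow> S \<subseteq> topspace M \<and> special_polyhedron (subtopology M S) \<and>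
     (if manifold_boundary M = {}
      then subtopology M (topspace M - S) homeomorphic_space top_of_set (ball (0 :: real^3) 1)
      else subtopology M (topspace M - S) homeomorphic_space
             prod_topology (subtopology M (manifold_boundary M)) (top_of_set {0..<1::real}))"

section \<open>Orientations, germs and sectors\<close>

text \<open>An orientation of a stratum is given by a homeomorphism onto the open disc in the complex
  plane, along which the standard orientation of the plane is pulled back.\<close>

definition stratum_orientation :: "'a topology \<Rightarrow> ('a set \<Rightarrow> 'a \<Rightarrow> complex) \<Rightarrow> bool" where
  "stratum_orientation P h \<longleftrightarrow>
     (\<forall>C\<in>strata P. homeomorphic_map (subtopology P C) (top_of_set open_disc) (h C))"

text \<open>A homeomorphism of the cone over \<open>K4\<close> onto a neighbourhood of a true vertex labels the four
  germs of true edges by the rays through \<open>axis i 1\<close>; permuting the coordinates realises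
  all labellings. The germs A, B, C, D are those with indices 1, 2, 3, 4 (where \<open>4 = 0\<close> in
  the index type).\<close>

definition germ_labelling :: "'a topology \<Rightarrow> ('a \<Rightarrow> real^4 \<Rightarrow> 'a) \<Rightarrow> bool" where
  "germ_labelling P k \<longleftrightarrow>
     (\<forall>v\<in>true_vertices P. embedding_map (top_of_set cone_K4) P (k v) \<and>
        openin P (k v ` cone_K4) \<and> k v 0 = v)"

definition germ_edge :: "'a topology \<Rightarrow> (real^4 \<Rightarrow> 'a) \<Rightarrow> 4 \<Rightarrow> 'a set" where
  "germ_edge P k i =
     connected_component_of_set (subtopology P (triple_points P)) (k (axis i (1/2)))"

definition triangle :: "complex set" where
  "triangle = {z. 0 < Re z \<and> 0 < Im z \<and> Re z + Im z < 1}"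

text \<open>The sector between germs \<open>i\<close> and \<open>j\<close>, with germ \<open>i\<close> on the imaginary and germ \<open>j\<close> on the
  real axis: a boundary path coming in along \<open>i\<close> and leaving along \<open>j\<close> has the sector on its
  left, so the standard orientation of the plane is that of the oriented sector from \<open>i\<close> to \<open>j\<close>.\<close>

definition sector :: "(real^4 \<Rightarrow> 'a) \<Rightarrow> 4 \<Rightarrow> 4 \<Rightarrow> complex \<Rightarrow> 'a" where
  "sector k i j z = k (axis i (Im z) + axis j (Re z))"

definition sector_stratum :: "'a topology \<Rightarrow> (real^4 \<Rightarrow> 'a) \<Rightarrow> 4 \<Rightarrow> 4 \<Rightarrow> 'a set" where
  "sector_stratum P k i j =
     connected_component_of_set (subtopology P (surface_points P)) (sector k i j (Complex (1/4) (1/4)))"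

text \<open>For injective continuous maps between planar regions.\<close>

definition orientation_preserving_on :: "complex set \<Rightarrow> (complex \<Rightarrow> complex) \<Rightarrow> bool" where
  "orientation_preserving_on U f \<longleftrightarrow>
     (\<forall>p r. 0 < r \<and> cball p r \<subseteq> U \<longrightarrow> winding_number (f \<circ> circlepath p r) (f p) = 1)"

definition sector_colour ::
  "('f \<Rightarrow> 'f) \<Rightarrow> 'a topology \<Rightarrow> ('a set \<Rightarrow> 'a \<Rightarrow> complex) \<Rightarrow> (real^4 \<Rightarrow> 'a) \<Rightarrow> ('a set \<Rightarrow> 'f) \<Rightarrow> 4 \<Rightarrow> 4 \<Rightarrow> 'f"
where
  "sector_colour neg P h k \<phi> i j =
     (let C = sector_stratum P k i j
      in if orientation_preserving_on triangle (h C \<circ> sector k i j) then \<phi> C else neg (\<phi> C))"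

section \<open>Symbols and the polynomial ring\<close>

text \<open>\<open>SixJ a b c f e d A B C D\<close> is the 6j4k-symbol with rows \<open>a b c\<close> and \<open>f e d\<close>, superscripts
  \<open>A, B\<close> and subscripts \<open>C, D\<close> (the lower row is read from left to right).\<close>

datatype ('f, 'g) tv_symbol =
    Weight 'f
  | SixJ 'f 'f 'f 'f 'f 'f 'g 'g 'g 'g

definition symbols_over :: "'f set \<Rightarrow> 'g set \<Rightarrow> ('f, 'g) tv_symbol set" where
  "symbols_over F G = {s. set1_tv_symbol s \<subseteq> F \<and> set2_tv_symbol s \<subseteq> G}"

inductive symbol_move :: "('f \<Rightarrow> 'f) \<Rightarrow> ('f, 'g) tv_symbol \<Rightarrow> ('f, 'g) tv_symbol \<Rightarrow> bool"
  for neg where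
  "symbol_move neg (Weight f) (Weight (neg f))"
| "symbol_move neg (SixJ a b c f e d A B C D) (SixJ b c a (neg e) (neg d) f C A B D)"
| "symbol_move neg (SixJ a b c f e d A B C D)
     (SixJ a (neg d) (neg e) (neg f) (neg c) (neg b) A B D C)"

definition symbol_equiv :: "'f set \<Rightarrow> 'g set \<Rightarrow> ('f \<Rightarrow> 'f) \<Rightarrow> ('f, 'g) tv_symbol rel" where
  "symbol_equiv F G neg =
     {(s, t). s \<in> symbols_over F G \<and> t \<in> symbols_over F G \<and>
        equivclp (\<lambda>u v. u \<in> symbols_over F G \<and> v \<in> symbols_over F G \<and> symbol_move neg u v) s t}"

type_synonym ('f, 'g) tv_var = "('f, 'g) tv_symbol set"
type_synonym ('f, 'g, 'k) tv_poly = "(('f, 'g) tv_var \<Rightarrow>\<^sub>0 nat) \<Rightarrow>\<^sub>0 'k"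

definition tv_vars :: "'f set \<Rightarrow> 'g set \<Rightarrow> ('f \<Rightarrow> 'f) \<Rightarrow> ('f, 'g) tv_var set" where
  "tv_vars F G neg = symbols_over F G // symbol_equiv F G neg"

definition tv_ring :: "'f set \<Rightarrow> 'g set \<Rightarrow> ('f \<Rightarrow> 'f) \<Rightarrow> ('f, 'g, 'k::field) tv_poly ring" where
  "tv_ring F G neg =
     \<lparr>carrier = {p. \<forall>\<mu>\<in>Poly_Mapping.keys p. Poly_Mapping.keys \<mu> \<subseteq> tv_vars F G neg},
      monoid.mult = (*), one = 1, ring.zero = 0, add = (+)\<rparr>"

definition tv_sym :: "'f set \<Rightarrow> 'g set \<Rightarrow> ('f \<Rightarrow> 'f) \<Rightarrow> ('f, 'g) tv_symbol \<Rightarrow> ('f, 'g, 'k::field) tv_poly" where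
  "tv_sym F G neg s = Poly_Mapping.single (Poly_Mapping.single (symbol_equiv F G neg `` {s}) 1) 1"

definition eval_poly :: "('f, 'g, 'k::field) tv_poly \<Rightarrow> (('f, 'g) tv_var \<Rightarrow> 'k alg_closure) \<Rightarrow> 'k alg_closure" where
  "eval_poly p x = (\<Sum>\<mu>\<in>Poly_Mapping.keys p. to_ac (Poly_Mapping.lookup p \<mu>) *
      (\<Prod>Z\<in>Poly_Mapping.keys \<mu>. x Z ^ Poly_Mapping.lookup \<mu> Z))"

section \<open>State sum, Turaev--Viro ideal and invariants\<close>

record 'a marked_spine =
  spine :: "'a set"
  orient :: "'a set \<Rightarrow> 'a \<Rightarrow> complex"
  label :: "'a \<Rightarrow> real^4 \<Rightarrow> 'a"

text \<open>The special spines of \<open>M\<close> with at least two true vertices, together with the auxiliary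
  choices (orientations of the strata, labellings of the germs) used to write down the state sum.\<close>

definition marked_spines :: "'a topology \<Rightarrow> 'a marked_spine set" where
  "marked_spines M = {S. special_spine M (spine S) \<and>
     2 \<le> card (true_vertices (subtopology M (spine S))) \<and>
     stratum_orientation (subtopology M (spine S)) (orient S) \<and>
     germ_labelling (subtopology M (spine S)) (label S)}"

definition colourings :: "'f set \<Rightarrow> 'g set \<Rightarrow> 'a topology \<Rightarrow> (('a set \<Rightarrow> 'f) \<times> ('a set \<Rightarrow> 'g)) set" where
  "colourings F G P = (strata P \<rightarrow>\<^sub>E F) \<times> (true_edges P \<rightarrow>\<^sub>E G)"

definition vertex_symbol ::
  "('f \<Rightarrow> 'f) \<Rightarrow> 'a topology \<Rightarrow> ('a set \<Rightarrow> 'a \<Rightarrow> complex) \<Rightarrow> (real^4 \<Rightarrow> 'a) \<Rightarrow>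
   ('a set \<Rightarrow> 'f) \<Rightarrow> ('a set \<Rightarrow> 'g) \<Rightarrow> ('f, 'g) tv_symbol"
where
  "vertex_symbol neg P h k \<phi> \<psi> =
     (let col = sector_colour neg P h k \<phi>; a = col 1 2; b = col 3 1; c = col 2 3;
          d = col 1 4; e = col 4 2; f = col 3 4; K = (\<lambda>i. \<psi> (germ_edge P k i))
      in SixJ a b c f e d (K 1) (K 2) (K 3) (K 4))"

definition state_sum ::
  "'f set \<Rightarrow> 'g set \<Rightarrow> ('f \<Rightarrow> 'f) \<Rightarrow> 'a topology \<Rightarrow> 'a marked_spine \<Rightarrow> ('f, 'g, 'k::field) tv_poly"
where
  "state_sum F G neg M S =
     (let P = subtopology M (spine S)
      in \<Sum>(\<phi>, \<psi>)\<in>colourings F G P.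
           (\<Prod>C\<in>strata P. tv_sym F G neg (Weight (\<phi> C))) *
           (\<Prod>v\<in>true_vertices P. tv_sym F G neg (vertex_symbol neg P (orient S) (label S v) \<phi> \<psi>)))"

definition tv_relation ::
  "'f set \<Rightarrow> 'g set \<Rightarrow> ('f \<Rightarrow> 'f) \<Rightarrow> (nat \<Rightarrow> 'f) \<Rightarrow> (nat \<Rightarrow> 'g) \<Rightarrow> ('f, 'g, 'k::field) tv_poly"
where
  "tv_relation F G neg j k =
     (let s = tv_sym F G neg in
      (\<Sum>A\<in>G.
         s (SixJ (j 1) (j 2) (j 3) (j 9) (j 8) (j 7) (k 1) (k 2) (k 3) A) *
         s (SixJ (j 4) (j 5) (j 6) (neg (j 9)) (neg (j 8)) (neg (j 7)) (k 4) (k 5) (k 6) A)) -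
      (\<Sum>A1\<in>G. \<Sum>A2\<in>G. \<Sum>A3\<in>G. \<Sum>i\<in>F.
         s (Weight i) *
         s (SixJ i (j 1) (j 2) (j 7) (neg (j 5)) (neg (j 4)) A1 A2 (k 1) (k 4)) *
         s (SixJ i (j 2) (j 3) (j 9) (neg (j 6)) (neg (j 5)) A2 A3 (k 3) (k 6)) *
         s (SixJ i (j 3) (j 1) (neg (j 8)) (neg (j 4)) (neg (j 6)) A3 A1 (k 2) (k 5))))"

definition tv_ideal :: "'f set \<Rightarrow> 'g set \<Rightarrow> ('f \<Rightarrow> 'f) \<Rightarrow> ('f, 'g, 'k::field) tv_poly set" where
  "tv_ideal F G neg = genideal (tv_ring F G neg)
     {tv_relation F G neg j k | j k. (\<forall>i\<in>{1..9}. j i \<in> F) \<and> (\<forall>i\<in>{1..6}. k i \<in> G)}"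

definition radical :: "('r, 'm) ring_scheme \<Rightarrow> 'r set \<Rightarrow> 'r set" where
  "radical R I = {p \<in> carrier R. \<exists>n::nat. 0 < n \<and> p [^]\<^bsub>R\<^esub> n \<in> I}"

text \<open>The invariants of \<open>M\<close> below are written with the marked spine \<open>S\<close> used to compute them, since
  their independence of \<open>S \<in> marked_spines M\<close> is a theorem.\<close>

definition ideal_tv ::
  "'f set \<Rightarrow> 'g set \<Rightarrow> ('f \<Rightarrow> 'f) \<Rightarrow> 'a topology \<Rightarrow> 'a marked_spine \<Rightarrow> ('f, 'g, 'k::field) tv_poly set"
where
  "ideal_tv F G neg M S = tv_ideal F G neg +>\<^bsub>tv_ring F G neg\<^esub> state_sum F G neg M S"

definition universal_tv ::
  "'f set \<Rightarrow> 'g set \<Rightarrow> ('f \<Rightarrow> 'f) \<Rightarrow> 'a topology \<Rightarrow> 'a marked_spine \<Rightarrow> ('f, 'g, 'k::field) tv_poly set"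
where
  "universal_tv F G neg M S =
     radical (tv_ring F G neg) (tv_ideal F G neg) +>\<^bsub>tv_ring F G neg\<^esub> state_sum F G neg M S"

definition tv_variety ::
  "'f set \<Rightarrow> 'g set \<Rightarrow> ('f \<Rightarrow> 'f) \<Rightarrow> (('f, 'g) tv_var \<Rightarrow> 'k::field alg_closure) set" where
  "tv_variety F G neg = {x \<in> tv_vars F G neg \<rightarrow>\<^sub>E UNIV. \<forall>p\<in>tv_ideal F G neg. eval_poly p x = 0}"

definition numerical_tv ::
  "'f set \<Rightarrow> 'g set \<Rightarrow> ('f \<Rightarrow> 'f) \<Rightarrow> (('f, 'g) tv_var \<Rightarrow> 'k::field alg_closure) \<Rightarrow>
   'a topology \<Rightarrow> 'a marked_spine \<Rightarrow> 'k alg_closure"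
where
  "numerical_tv F G neg x M S = eval_poly (state_sum F G neg M S) x"

end

theory Submission
  imports Defs
begin

text \<open>Write \<open>p\<^sub>1\<close>, \<open>p\<^sub>2\<close> for the state sums of the two spines and \<open>I\<close> for the
  Turaev--Viro ideal. The universal numerical invariants are the cosets of \<open>p\<^sub>1\<close> and \<open>p\<^sub>2\<close>
  modulo the radical of \<open>I\<close>, so they agree iff \<open>p\<^sub>1 - p\<^sub>2\<close> lies in that radical. The numerical
  invariants agree iff \<open>p\<^sub>1 - p\<^sub>2\<close> vanishes at every zero of \<open>I\<close> over the algebraic closure. By
  Hilbert's Nullstellensatz (\<open>nullstellensatz\<close>), in the form where the polynomials have
  coefficients in an arbitrary field and the zeros are taken in its algebraic closure, these are
  the same condition.

  The Nullstellensatz holds for the following reason. If no power of \<open>p\<close> lies in \<open>I\<close>, then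
  some prime ideal \<open>P \<supseteq> I\<close> misses \<open>p\<close> (\<open>exists_prime_avoiding_powers\<close>).
  A zero of \<open>P\<close> at which \<open>p\<close> does not vanish is built one variable at a time. The tool
  is \<open>extend_specialisation\<close>: the condition that \<open>b \<notin> P\<close>
  be nonzero after the new variable is given a value can be traded for the condition that some
  \<open>a \<notin> P\<close> in the old variables alone be nonzero. After all variables have been eliminated,
  the condition is that a nonzero constant be nonzero.

  The Nullstellensatz only applies to \<open>p\<^sub>1 - p\<^sub>2\<close> if the state sums are polynomials in the finitely
  many variables of the ring. This is a geometric statement. The colour of a sector or of a germ
  at a true vertex lies in the colour set only because the stratum or true edge named by the
  definitions really is one, that is, because in the cone over \<open>K4\<close> the base point of a sector has
  a disc neighbourhood and the base point of a ray has a neighbourhood of the form line times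
  tripod. Explicit charts show this (\<open>sector_is_surface_point\<close>, \<open>germ_is_triple_point\<close>).\<close>

(* Below, coefficients and degrees are those of the type of univariate polynomials, and the dollar
   sign is the component of a vector. *)
hide_const (open) up_ring.coeff up_ring.monom Module.smult Polynomials.degree Polynomials.lead_coeff
no_notation fps_nth (infixl "$" 75)

section \<open>Prime ideals in subrings\<close>

text \<open>Subrings and their ideals are subsets of one ambient ring, so that the polynomial rings in
  growing sets of variables, and the restrictions of one prime ideal to all of them, can be
  compared without embeddings.\<close>

locale unital_subring =
  fixes A :: "'r::comm_ring_1 set"
  assumes one_mem: "1 \<in> A"
    and diff_mem: "a \<in> A \<Longrightarrow> b \<in> A \<Longrightarrow> a - b \<in> A"
    and mult_mem: "a \<in> A \<Longrightarrow> b \<in> A \<Longrightarrow> a * b \<in> A"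
begin

lemma zero_mem: "0 \<in> A"
  using diff_mem[OF one_mem one_mem] by simp

lemma add_mem: "a \<in> A \<Longrightarrow> b \<in> A \<Longrightarrow> a + b \<in> A"
  using diff_mem[of a "0 - b"] diff_mem[OF zero_mem] by simp

lemma power_mem: "a \<in> A \<Longrightarrow> a ^ n \<in> A"
  by (induction n) (auto intro: one_mem mult_mem)

lemma sum_mem: "(\<And>i. i \<in> Y \<Longrightarrow> f i \<in> A) \<Longrightarrow> sum f Y \<in> A"
  by (induction Y rule: infinite_finite_induct) (auto intro: zero_mem add_mem)

lemma prod_mem: "(\<And>i. i \<in> Y \<Longrightarrow> f i \<in> A) \<Longrightarrow> prod f Y \<in> A"
  by (induction Y rule: infinite_finite_induct) (auto intro: one_mem mult_mem)

end

definition ideal_on :: "'r::comm_ring_1 set \<Rightarrow> 'r set \<Rightarrow> bool" where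
  "ideal_on C I \<longleftrightarrow> I \<subseteq> C \<and> 0 \<in> I \<and> (\<forall>a\<in>I. \<forall>b\<in>I. a + b \<in> I) \<and> (\<forall>c\<in>C. \<forall>a\<in>I. c * a \<in> I)"

definition prime_on :: "'r::comm_ring_1 set \<Rightarrow> 'r set \<Rightarrow> bool" where
  "prime_on C P \<longleftrightarrow> ideal_on C P \<and> 1 \<notin> P \<and> (\<forall>a\<in>C. \<forall>b\<in>C. a * b \<in> P \<longrightarrow> a \<in> P \<or> b \<in> P)"

lemma ideal_onD:
  assumes "ideal_on C I"
  shows "I \<subseteq> C" "0 \<in> I" "a \<in> I \<Longrightarrow> b \<in> I \<Longrightarrow> a + b \<in> I" "c \<in> C \<Longrightarrow> a \<in> I \<Longrightarrow> c * a \<in> I"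
  using assms by (auto simp: ideal_on_def)

lemma (in unital_subring) ideal_on_diff:
  assumes "ideal_on A I" "a \<in> I" "b \<in> I"
  shows "a - b \<in> I"
  using ideal_onD(3)[OF assms(1,2), of "(0 - 1) * b"] ideal_onD(4)[OF assms(1), of "0 - 1" b]
    diff_mem[OF zero_mem one_mem] assms(3) by simp

lemma (in unital_subring) ideal_on_add_principal:
  assumes "ideal_on A I" "a \<in> A"
  shows "ideal_on A {m + c * a | m c. m \<in> I \<and> c \<in> A}"
  unfolding ideal_on_def
proof (intro conjI ballI subsetI)
  let ?J = "{m + c * a | m c. m \<in> I \<and> c \<in> A}"
  show "x \<in> A" if "x \<in> ?J" for x
    using that ideal_onD(1)[OF assms(1)] assms(2) by (auto intro!: add_mem mult_mem)
  show "0 \<in> ?J"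
    using ideal_onD(2)[OF assms(1)] zero_mem by force
  show "x + y \<in> ?J" if xy: "x \<in> ?J" "y \<in> ?J" for x y
  proof -
    obtain m c m' c' where mc: "m \<in> I" "c \<in> A" "m' \<in> I" "c' \<in> A" "x = m + c * a" "y = m' + c' * a"
      using xy by blast
    have "x + y = (m + m') + (c + c') * a"
      using mc by (simp add: algebra_simps)
    then show ?thesis
      using mc ideal_onD(3)[OF assms(1)] add_mem by blast
  qed
  show "d * x \<in> ?J" if dx: "d \<in> A" "x \<in> ?J" for d x
  proof -
    obtain m c where mc: "m \<in> I" "c \<in> A" "x = m + c * a"
      using dx by blast
    have "d * x = d * m + (d * c) * a"
      using mc by (simp add: algebra_simps)
    then show ?thesis
      using mc dx(1) ideal_onD(4)[OF assms(1)] mult_mem by blast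
  qed
qed

text \<open>Zorn's lemma gives an ideal \<open>M\<close> maximal among those that contain \<open>I\<close> and no power of
  \<open>p\<close>. It is prime: if \<open>a\<close> and \<open>b\<close> were outside \<open>M\<close>, then by maximality \<open>M + (a)\<close> and \<open>M + (b)\<close>
  would both contain powers of \<open>p\<close>, whose product lies in \<open>M + (a * b)\<close>.\<close>

lemma (in unital_subring) exists_prime_avoiding_powers:
  assumes I: "ideal_on A I" and p: "p \<in> A" and powers: "\<And>n. p ^ n \<notin> I"
  shows "\<exists>P. prime_on A P \<and> I \<subseteq> P \<and> p \<notin> P"
proof -
  define \<A> where "\<A> = {J. ideal_on A J \<and> I \<subseteq> J \<and> (\<forall>n. p ^ n \<notin> J)}"
  have "\<exists>M\<in>\<A>. \<forall>Y\<in>\<A>. M \<subseteq> Y \<longrightarrow> Y = M"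
  proof (rule subset_Zorn_nonempty)
    show "\<A> \<noteq> {}"
      using I powers by (auto simp: \<A>_def)
    fix \<C> assume "\<C> \<noteq> {}" and chain: "subset.chain \<A> \<C>"
    then have sub: "\<C> \<subseteq> \<A>" and lin: "\<And>J K. J \<in> \<C> \<Longrightarrow> K \<in> \<C> \<Longrightarrow> J \<subseteq> K \<or> K \<subseteq> J"
      by (auto simp: subset_chain_def)
    have ideals: "ideal_on A J" if "J \<in> \<C>" for J
      using sub that by (auto simp: \<A>_def)
    have "ideal_on A (\<Union>\<C>)"
      unfolding ideal_on_def
    proof (intro conjI ballI)
      show "\<Union>\<C> \<subseteq> A" "0 \<in> \<Union>\<C>"
        using \<open>\<C> \<noteq> {}\<close> ideals ideal_onD(1,2) by blast+
      show "a + b \<in> \<Union>\<C>" if ab: "a \<in> \<Union>\<C>" "b \<in> \<Union>\<C>" for a b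
      proof -
        obtain J where "J \<in> \<C>" "a \<in> J" "b \<in> J"
          using ab lin by blast
        then show ?thesis
          using ideal_onD(3)[OF ideals] by blast
      qed
      show "c * a \<in> \<Union>\<C>" if "c \<in> A" "a \<in> \<Union>\<C>" for a c
        using that ideal_onD(4)[OF ideals] by blast
    qed
    then show "\<Union>\<C> \<in> \<A>"
      using sub \<open>\<C> \<noteq> {}\<close> by (auto simp: \<A>_def)
  qed
  then obtain M where M: "ideal_on A M" "I \<subseteq> M" "\<And>n. p ^ n \<notin> M"
    and max: "\<And>Y. Y \<in> \<A> \<Longrightarrow> M \<subseteq> Y \<Longrightarrow> Y = M"
    by (auto simp: \<A>_def)
  have power_in: "\<exists>n m c. p ^ n = m + c * a \<and> m \<in> M \<and> c \<in> A" if a: "a \<in> A" "a \<notin> M" for a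
  proof (rule ccontr)
    assume no: "\<not> ?thesis"
    let ?J = "{m + c * a | m c. m \<in> M \<and> c \<in> A}"
    have "M \<subseteq> ?J"
      using zero_mem by force
    moreover have "a \<in> ?J"
      using ideal_onD(2)[OF M(1)] one_mem by force
    moreover have "?J \<in> \<A>"
      using no ideal_on_add_principal[OF M(1) a(1)] M(2) \<open>M \<subseteq> ?J\<close> by (auto simp: \<A>_def)
    ultimately show False
      using max[of ?J] a(2) by blast
  qed
  have "prime_on A M"
    unfolding prime_on_def
  proof (intro conjI ballI impI)
    show "1 \<notin> M" using M(3)[of 0] by simp
    fix a b assume ab: "a \<in> A" "b \<in> A" "a * b \<in> M"
    show "a \<in> M \<or> b \<in> M"
    proof (rule ccontr)
      assume "\<not> (a \<in> M \<or> b \<in> M)"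
      then obtain i m c j m' c' where
        mc: "p ^ i = m + c * a" "m \<in> M" "c \<in> A" and mc': "p ^ j = m' + c' * b" "m' \<in> M" "c' \<in> A"
        using power_in ab(1,2) by metis
      have "p ^ (i + j) = (p ^ j) * m + ((c * a) * m' + (c * c') * (a * b))"
        by (simp add: power_add mc(1) mc'(1) algebra_simps)
      also have "\<dots> \<in> M"
        using power_mem[OF p, of j] mult_mem[OF mc(3) ab(1)] mult_mem[OF mc(3) mc'(3)]
        by (intro ideal_onD(3)[OF M(1)] ideal_onD(4)[OF M(1) _ mc(2)]
            ideal_onD(4)[OF M(1) _ mc'(2)] ideal_onD(4)[OF M(1) _ ab(3)])
      finally show False using M(3) by blast
    qed
  qed (use M in auto)
  then show ?thesis
    using M(2) M(3)[of 1] by auto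
qed

section \<open>Extending a homomorphism by one element\<close>

definition polys_over :: "'r::comm_ring_1 set \<Rightarrow> 'r poly set" where
  "polys_over A = {f. \<forall>i. coeff f i \<in> A}"

context unital_subring
begin

lemma polys_over_add: "f \<in> polys_over A \<Longrightarrow> g \<in> polys_over A \<Longrightarrow> f + g \<in> polys_over A"
  by (auto simp: polys_over_def add_mem)

lemma polys_over_diff: "f \<in> polys_over A \<Longrightarrow> g \<in> polys_over A \<Longrightarrow> f - g \<in> polys_over A"
  by (auto simp: polys_over_def diff_mem)

lemma polys_over_mult: "f \<in> polys_over A \<Longrightarrow> g \<in> polys_over A \<Longrightarrow> f * g \<in> polys_over A"
  by (auto simp: polys_over_def coeff_mult intro!: sum_mem mult_mem)

lemma polys_over_smult: "c \<in> A \<Longrightarrow> f \<in> polys_over A \<Longrightarrow> smult c f \<in> polys_over A"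
  by (auto simp: polys_over_def mult_mem)

lemma polys_over_monom: "c \<in> A \<Longrightarrow> monom c n \<in> polys_over A"
  by (auto simp: polys_over_def zero_mem)

lemma polys_over_power: "f \<in> polys_over A \<Longrightarrow> f ^ n \<in> polys_over A"
proof (induction n)
  case 0
  then show ?case using polys_over_monom[OF one_mem, of 0] by (simp add: monom_0 one_pCons)
qed (auto intro: polys_over_mult)

lemma poly_mem: "f \<in> polys_over A \<Longrightarrow> z \<in> A \<Longrightarrow> poly f z \<in> A"
  unfolding poly_altdef polys_over_def by (auto intro!: sum_mem mult_mem power_mem)

text \<open>Division with remainder needs no division in the coefficient ring if the dividend may be
  multiplied by a power of the leading coefficient of the divisor.\<close>

lemma pseudo_division:
  assumes "q \<in> polys_over A" "f \<in> polys_over A"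
  shows "\<exists>e u r. u \<in> polys_over A \<and> r \<in> polys_over A \<and>
           smult (lead_coeff q ^ e) f = q * u + r \<and> (r = 0 \<or> degree r < degree q)"
  using assms(2)
proof (induction "length (coeffs f)" arbitrary: f rule: less_induct)
  case less
  let ?l = "lead_coeff q"
  show ?case
  proof (cases "f = 0 \<or> degree f < degree q")
    case True
    then show ?thesis
      using less.prems polys_over_monom[OF zero_mem, of 0]
      by (intro exI[of _ 0] exI[of _ f]) auto
  next
    case False
    \<comment> \<open>Cancel the leading term of \<open>f\<close>, at the cost of one factor \<open>lead_coeff q\<close>.\<close>
    let ?c = "lead_coeff f" and ?n = "degree f - degree q"
    let ?m = "monom ?c ?n"
    let ?f = "smult ?l f - q * ?m"
    have l: "?l \<in> A" and c: "?c \<in> A"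
      using assms(1) less.prems by (auto simp: polys_over_def)
    have f': "?f \<in> polys_over A"
      using assms(1) less.prems l c
      by (intro polys_over_diff polys_over_mult polys_over_smult polys_over_monom) auto
    have "degree (q * ?m) \<le> degree f"
      using False degree_mult_le[of q ?m] degree_monom_le[of ?c ?n] by linarith
    then have deg: "degree ?f \<le> degree f"
      by (intro degree_diff_le) (auto intro: degree_smult_le)
    have "coeff (q * ?m) (degree f) = ?l * ?c"
      using False coeff_monom_mult[of ?c ?n q "degree f"] by (simp add: mult.commute)
    then have "coeff ?f (degree f) = 0"
      by simp
    then have "?f = 0 \<or> degree ?f < degree f"
      using deg eq_zero_or_degree_less by blast
    then have "length (coeffs ?f) < length (coeffs f)"
      using False by (cases "?f = 0") (auto simp: length_coeffs_degree)
    from less.hyps[OF this f'] obtain e u r where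
      eur: "u \<in> polys_over A" "r \<in> polys_over A" "smult (?l ^ e) ?f = q * u + r"
        "r = 0 \<or> degree r < degree q"
      by blast
    have "smult (?l ^ Suc e) f = smult (?l ^ e) ?f + q * smult (?l ^ e) ?m"
      by (simp add: smult_diff_right mult.commute)
    also have "\<dots> = q * (u + smult (?l ^ e) ?m) + r"
      by (simp add: eur(3) algebra_simps)
    finally show ?thesis
      using eur l c
      by (intro exI[of _ "Suc e"] exI[of _ "u + smult (?l ^ e) ?m"] exI[of _ r])
        (auto intro!: polys_over_add polys_over_smult polys_over_monom power_mem)
  qed
qed

end

locale unital_hom =
  fixes \<phi> :: "'r::comm_ring_1 \<Rightarrow> 's::comm_ring_1"
  assumes hom_one: "\<phi> 1 = 1"
    and hom_add: "\<phi> (a + b) = \<phi> a + \<phi> b"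
    and hom_mult: "\<phi> (a * b) = \<phi> a * \<phi> b"
begin

lemma hom_zero: "\<phi> 0 = 0"
  using hom_add[of 0 0] by simp

lemma hom_power: "\<phi> (a ^ n) = \<phi> a ^ n"
  by (induction n) (simp_all add: hom_one hom_mult)

lemma hom_sum: "\<phi> (sum f Y) = (\<Sum>i\<in>Y. \<phi> (f i))"
  by (induction Y rule: infinite_finite_induct) (simp_all add: hom_zero hom_add)

lemma hom_diff: "\<phi> (a - b) = \<phi> a - \<phi> b"
  using hom_add[of "a - b" b] by (simp add: algebra_simps)

lemma map_poly_hom_add: "map_poly \<phi> (f + g) = map_poly \<phi> f + map_poly \<phi> g"
  by (rule poly_eqI) (simp add: coeff_map_poly hom_zero hom_add)

lemma map_poly_hom_mult: "map_poly \<phi> (f * g) = map_poly \<phi> f * map_poly \<phi> g"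
  by (rule poly_eqI) (simp add: coeff_map_poly hom_zero coeff_mult hom_sum hom_mult)

lemma map_poly_hom_power: "map_poly \<phi> (f ^ n) = map_poly \<phi> f ^ n"
  by (induction n) (simp_all add: hom_one map_poly_hom_mult)

lemma map_poly_hom_smult: "map_poly \<phi> (smult c f) = smult (\<phi> c) (map_poly \<phi> f)"
  by (rule poly_eqI) (simp add: coeff_map_poly hom_zero hom_mult)

end

text \<open>Over an algebraically closed field, \<open>q\<close> is a product of \<open>degree q\<close> linear factors, each of
  which divides \<open>g\<close>. This is the Nullstellensatz in one variable, with an exponent that depends
  on the degree of \<open>q\<close> only.\<close>

lemma dvd_power_degree_if_roots:
  fixes q g :: "'k::alg_closed_field poly"
  assumes "q \<noteq> 0" and roots: "\<And>\<xi>. poly q \<xi> = 0 \<Longrightarrow> poly g \<xi> = 0"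
  shows "q dvd g ^ degree q"
proof -
  obtain R where R: "size R = degree q" "q = smult (lead_coeff q) (\<Prod>\<xi>\<in>#R. [:-\<xi>, 1:])"
    using alg_closed_imp_factorization[OF assms(1)] by blast
  have "poly q \<xi> = 0" if "\<xi> \<in># R" for \<xi>
  proof -
    obtain R' where "R = add_mset \<xi> R'"
      using multi_member_split \<open>\<xi> \<in># R\<close> by metis
    then show ?thesis by (subst R(2)) simp
  qed
  then have "\<forall>\<xi>\<in>#R. [:-\<xi>, 1:] dvd g"
    using roots by (simp add: poly_eq_0_iff_dvd[symmetric])
  then have "(\<Prod>\<xi>\<in>#R. [:-\<xi>, 1:]) dvd g ^ size R"
  proof (induction R)
    case (add \<xi> R)
    then show ?case
      by (auto simp del: mult_pCons_left intro!: mult_dvd_mono)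
  qed simp
  then show ?thesis
    using R assms(1) by (metis leading_coeff_0_iff smult_dvd_iff)
qed

text \<open>A root \<open>\<xi>\<close> of the nonconstant polynomial \<open>1 + X * g\<close> satisfies \<open>\<xi> * g(\<xi>) = -1\<close>.\<close>

lemma exists_nonroot:
  fixes g :: "'k::alg_closed_field poly"
  assumes "g \<noteq> 0"
  shows "\<exists>\<xi>. poly g \<xi> \<noteq> 0"
proof -
  have "degree (pCons 1 g) > 0"
    using assms by simp
  then obtain \<xi> where "poly (pCons 1 g) \<xi> = 0"
    using alg_closed_imp_poly_has_root by blast
  then show ?thesis by (intro exI[of _ \<xi>]) auto
qed

text \<open>Below the minimal degree of a polynomial that vanishes modulo \<open>P\<close> without having its leading
  coefficient in \<open>P\<close>, the leading term of a polynomial that vanishes modulo \<open>P\<close> can be removed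
  again and again, which puts all coefficients into \<open>P\<close>.\<close>

lemma (in unital_subring) coeffs_mem_if_below_min_degree:
  assumes C: "unital_subring C" "A \<subseteq> C" "z \<in> C" and P: "ideal_on C P"
    and min: "\<And>f. f \<in> polys_over A \<Longrightarrow> poly f z \<in> P \<Longrightarrow> degree f < n \<Longrightarrow> lead_coeff f \<in> P"
    and r: "r \<in> polys_over A" "poly r z \<in> P" "degree r < n"
  shows "coeff r i \<in> P"
  using r
proof (induction "length (coeffs r)" arbitrary: r rule: less_induct)
  case less
  show ?case
  proof (cases "r = 0")
    case False
    let ?m = "monom (lead_coeff r) (degree r)"
    let ?r = "r - ?m"
    have lc: "lead_coeff r \<in> P"
      using min less.prems by blast
    have lcA: "lead_coeff r \<in> A"
      using less.prems by (auto simp: polys_over_def)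
    have deg: "degree ?r \<le> degree r"
      by (intro degree_diff_le degree_monom_le) auto
    have "?r = 0 \<or> degree ?r < degree r"
      using deg eq_zero_or_degree_less[of ?r "degree r"] by simp
    then have len: "length (coeffs ?r) < length (coeffs r)"
      using False by (cases "?r = 0") (simp_all add: length_coeffs_degree)
    have "z ^ degree r * lead_coeff r \<in> P"
      using lc C by (intro ideal_onD(4)[OF P] unital_subring.power_mem) auto
    then have "poly ?r z \<in> P"
      using unital_subring.ideal_on_diff[OF C(1) P less.prems(2)] 
      by (simp add: poly_monom mult.commute)
    then have "coeff ?r i \<in> P"
      using less.prems deg lcA
      by (intro less.hyps[OF len] polys_over_diff polys_over_monom) auto
    moreover have "coeff ?m i \<in> P"
      using lc ideal_onD(2)[OF P] by auto
    ultimately show ?thesis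
      using ideal_onD(3)[OF P, of "coeff ?r i" "coeff ?m i"] by simp
  qed (use ideal_onD(2)[OF P] in simp)
qed

lemma (in unital_subring) mem_if_coeffs_mem:
  assumes C: "unital_subring C" "z \<in> C" and P: "ideal_on C P" and "\<And>i. coeff r i \<in> P"
  shows "poly r z \<in> P"
proof -
  have "(\<Sum>i\<in>Y. coeff r i * z ^ i) \<in> P" for Y
    using assms
    by (induction Y rule: infinite_finite_induct)
      (auto intro!: ideal_onD(2,3)[OF P] ideal_onD(4)[OF P, of "z ^ _" "coeff r _", simplified mult.commute]
        unital_subring.power_mem simp: mult.commute)
  then show ?thesis by (simp add: poly_altdef)
qed

text \<open>Think of \<open>\<phi>\<close> as a point of the variety of \<open>P\<close> in the coordinates of \<open>A\<close>, and of \<open>\<xi>\<close> as a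
  value for the new coordinate \<open>z\<close>.

  If \<open>z\<close> is transcendental over \<open>A\<close> modulo \<open>P\<close>, then every value for \<open>z\<close> extends the point, and
  \<open>g\<close> stays nonzero for a suitable value as soon as one of its coefficients does. Otherwise let \<open>q\<close> be
  a polynomial of minimal degree \<open>d\<close> that vanishes at \<open>z\<close> modulo \<open>P\<close> and has its leading
  coefficient \<open>l\<close> outside \<open>P\<close>. Pseudo-division by \<open>q\<close> shows that every root of \<open>\<phi>(q)\<close> is an
  admissible value when \<open>\<phi>(l) \<noteq> 0\<close>. It remains to find a root at which \<open>\<phi>(g)\<close> is nonzero. If
  there were none, \<open>\<phi>(q)\<close> would divide \<open>\<phi>(g)^d\<close>, hence also the image of the remainder \<open>r\<close> of
  \<open>g^d\<close>, which has degree less than \<open>d\<close>. This is impossible when \<open>\<phi>\<close> is nonzero at some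
  coefficient of \<open>r\<close>, and one coefficient is outside \<open>P\<close> because \<open>l\<close> and \<open>g\<close> are. So \<open>a\<close> is the
  product of \<open>l\<close> with such a coefficient.\<close>

lemma (in unital_subring) extend_specialisation:
  assumes C: "unital_subring C" "A \<subseteq> C" "z \<in> C" and prime: "prime_on C P"
    and g: "g \<in> polys_over A" "poly g z \<notin> P"
  shows "\<exists>a\<in>A - P. \<forall>\<phi> :: 'r \<Rightarrow> 'k::alg_closed_field.
           unital_hom \<phi> \<and> (\<forall>c\<in>A \<inter> P. \<phi> c = 0) \<and> \<phi> a \<noteq> 0 \<longrightarrow>
           (\<exists>\<xi>. (\<forall>f\<in>polys_over A. poly f z \<in> P \<longrightarrow> poly (map_poly \<phi> f) \<xi> = 0) \<and>
                 poly (map_poly \<phi> g) \<xi> \<noteq> 0)"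
proof -
  have P: "ideal_on C P"
    using prime by (simp add: prime_on_def)
  interpret C: unital_subring C by (fact C(1))
  have primeD: "a \<in> P \<or> b \<in> P" if "a \<in> C" "b \<in> C" "a * b \<in> P" for a b
    using prime that by (auto simp: prime_on_def)
  have power_notin: "a ^ n \<notin> P" if "a \<in> C" "a \<notin> P" for a n
    using prime that by (induction n) (auto simp: prime_on_def dest: primeD intro: C.power_mem)
  have over: "polys_over A \<subseteq> polys_over C"
    using C(2) by (auto simp: polys_over_def)
  have coeffA: "coeff f i \<in> A" if "f \<in> polys_over A" for f i
    using that by (auto simp: polys_over_def)
  show ?thesis
  proof (cases "\<exists>q. q \<in> polys_over A \<and> poly q z \<in> P \<and> lead_coeff q \<notin> P")
    case False
    then have coeffs: "coeff f i \<in> P" if "f \<in> polys_over A" "poly f z \<in> P" for f i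
      using coeffs_mem_if_below_min_degree[OF C P, of "Suc (degree f)" f i] that by blast
    obtain i where i: "coeff g i \<notin> P"
      using mem_if_coeffs_mem[OF C(1,3) P] g(2) by blast
    show ?thesis
    proof (intro bexI[of _ "coeff g i"] allI impI)
      fix \<phi> :: "'r \<Rightarrow> 'k"
      assume \<phi>: "unital_hom \<phi> \<and> (\<forall>c\<in>A \<inter> P. \<phi> c = 0) \<and> \<phi> (coeff g i) \<noteq> 0"
      then interpret unital_hom \<phi> by simp
      have "coeff (map_poly \<phi> g) i \<noteq> 0"
        using \<phi> by (simp add: coeff_map_poly hom_zero)
      then have "map_poly \<phi> g \<noteq> 0" by auto
      then obtain \<xi> where "poly (map_poly \<phi> g) \<xi> \<noteq> 0"
        using exists_nonroot by blast
      moreover have "map_poly \<phi> f = 0" if "f \<in> polys_over A" "poly f z \<in> P" for f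
        using that coeffs coeffA \<phi> by (intro poly_eqI) (auto simp: coeff_map_poly hom_zero)
      ultimately show "\<exists>\<xi>. (\<forall>f\<in>polys_over A. poly f z \<in> P \<longrightarrow> poly (map_poly \<phi> f) \<xi> = 0) \<and>
                 poly (map_poly \<phi> g) \<xi> \<noteq> 0"
        by (intro exI[of _ \<xi>]) auto
    qed (use i coeffA g in auto)
  next
    case True
    then obtain q where q: "q \<in> polys_over A" "poly q z \<in> P" "lead_coeff q \<notin> P"
      and min: "\<And>f. f \<in> polys_over A \<Longrightarrow> poly f z \<in> P \<Longrightarrow> degree f < degree q \<Longrightarrow> lead_coeff f \<in> P"
      using ex_has_least_nat[of "\<lambda>q. q \<in> polys_over A \<and> poly q z \<in> P \<and> lead_coeff q \<notin> P" _ degree]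
      by (metis leD)
    let ?l = "lead_coeff q"
    have l: "?l \<in> A" using coeffA q(1) .
    have "degree q \<noteq> 0"
    proof
      assume "degree q = 0"
      then have "poly q z = ?l" by (auto elim: degree_eq_zeroE)
      with q show False by simp
    qed
    have divide: "\<exists>e u r. u \<in> polys_over A \<and> r \<in> polys_over A \<and> degree r < degree q \<and>
        smult (?l ^ e) f = q * u + r" if "f \<in> polys_over A" for f
      using pseudo_division[OF q(1) that] \<open>degree q \<noteq> 0\<close> by (metis degree_0 gr0I)
    have qu: "poly (q * u) z \<in> P" if "u \<in> polys_over A" for u
      using ideal_onD(4)[OF P C.poly_mem[OF subsetD[OF over that] C(3)] q(2)]
      by (simp only: poly_mult mult.commute[of "poly q z"])
    obtain e u r where r: "u \<in> polys_over A" "r \<in> polys_over A" "degree r < degree q"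
        "smult (?l ^ e) (g ^ degree q) = q * u + r"
      using divide[OF polys_over_power[OF g(1)]] by metis
    have "poly r z \<notin> P"
    proof
      assume "poly r z \<in> P"
      then have "poly (q * u + r) z \<in> P"
        using ideal_onD(3)[OF P qu[OF r(1)]] by simp
      then have "?l ^ e * poly g z ^ degree q \<in> P"
        by (simp add: r(4)[symmetric] poly_power)
      moreover have "?l \<in> C" "poly g z \<in> C"
        using l C over g C.poly_mem by auto
      ultimately show False
        using primeD C.power_mem power_notin q(3) g(2) by meson
    qed
    then obtain i where i: "coeff r i \<notin> P"
      using mem_if_coeffs_mem[OF C(1,3) P] by blast
    show ?thesis
    proof (intro bexI[of _ "?l * coeff r i"] allI impI)
      have "?l \<in> C" "coeff r i \<in> C" using l C coeffA r by auto
      then show "?l * coeff r i \<in> A - P"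
        using primeD q(3) i l coeffA[OF r(2)] mult_mem by blast
      fix \<phi> :: "'r \<Rightarrow> 'k"
      assume \<phi>: "unital_hom \<phi> \<and> (\<forall>c\<in>A \<inter> P. \<phi> c = 0) \<and> \<phi> (?l * coeff r i) \<noteq> 0"
      then interpret unital_hom \<phi> by simp
      have \<phi>l: "\<phi> ?l \<noteq> 0" and \<phi>r: "\<phi> (coeff r i) \<noteq> 0"
        using \<phi> by (auto simp: hom_mult)
      have deg: "degree (map_poly \<phi> q) = degree q"
        using \<phi>l by (rule map_poly_degree_eq)
      then have q0: "map_poly \<phi> q \<noteq> 0"
        using \<open>degree q \<noteq> 0\<close> by auto
      have "\<exists>\<xi>. poly (map_poly \<phi> q) \<xi> = 0 \<and> poly (map_poly \<phi> g) \<xi> \<noteq> 0"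
      proof (rule ccontr)
        assume "\<not> ?thesis"
        then have "map_poly \<phi> q dvd map_poly \<phi> g ^ degree q"
          using dvd_power_degree_if_roots[OF q0] deg by auto
        then have "map_poly \<phi> q dvd map_poly \<phi> (smult (?l ^ e) (g ^ degree q))"
          by (simp add: map_poly_hom_smult map_poly_hom_power dvd_smult)
        then have "map_poly \<phi> q dvd map_poly \<phi> r"
          by (simp add: r(4) map_poly_hom_add map_poly_hom_mult dvd_add_right_iff)
        moreover have "map_poly \<phi> r \<noteq> 0"
          using \<phi>r by (metis coeff_0 coeff_map_poly hom_zero)
        moreover have "degree (map_poly \<phi> r) < degree (map_poly \<phi> q)"
          using deg r(3) map_poly_degree_leq[of \<phi> r] by linarith
        ultimately show False
          using dvd_imp_degree_le by (metis leD)
      qed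
      then obtain \<xi> where \<xi>: "poly (map_poly \<phi> q) \<xi> = 0" "poly (map_poly \<phi> g) \<xi> \<noteq> 0"
        by blast
      have "poly (map_poly \<phi> f) \<xi> = 0" if f: "f \<in> polys_over A" "poly f z \<in> P" for f
      proof -
        obtain e' u' r' where r': "u' \<in> polys_over A" "r' \<in> polys_over A" "degree r' < degree q"
            "smult (?l ^ e') f = q * u' + r'"
          using divide[OF f(1)] by metis
        have "?l ^ e' * poly f z \<in> P"
          using l C f by (intro ideal_onD(4)[OF P] C.power_mem) auto
        then have "poly (q * u' + r') z \<in> P"
          by (simp add: r'(4)[symmetric])
        then have "poly r' z \<in> P"
          using C.ideal_on_diff[OF P _ qu[OF r'(1)]] by fastforce
        then have "coeff r' i \<in> P" for i
          using coeffs_mem_if_below_min_degree[OF C P min] r' by blast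
        then have "map_poly \<phi> r' = 0"
          using \<phi> coeffA[OF r'(2)] by (intro poly_eqI) (auto simp: coeff_map_poly hom_zero)
        then have "smult (\<phi> ?l ^ e') (map_poly \<phi> f) = map_poly \<phi> q * map_poly \<phi> u'"
          using arg_cong[OF r'(4), of "map_poly \<phi>"]
          by (simp add: map_poly_hom_smult map_poly_hom_add map_poly_hom_mult hom_power)
        then have "\<phi> ?l ^ e' * poly (map_poly \<phi> f) \<xi> = 0"
          using \<xi>(1) by (metis mult_zero_left poly_mult poly_smult)
        then show ?thesis
          using \<phi>l by simp
      qed
      with \<xi>(2) show "\<exists>\<xi>. (\<forall>f\<in>polys_over A. poly f z \<in> P \<longrightarrow> poly (map_poly \<phi> f) \<xi> = 0) \<and>
                 poly (map_poly \<phi> g) \<xi> \<noteq> 0"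
        by blast
    qed
  qed
qed

section \<open>The Nullstellensatz\<close>

type_synonym ('v, 'k) mpoly = "('v \<Rightarrow>\<^sub>0 nat) \<Rightarrow>\<^sub>0 'k"

definition mpolys_in :: "'v set \<Rightarrow> ('v, 'k::comm_ring_1) mpoly set" where
  "mpolys_in V = {p. \<forall>\<mu>\<in>Poly_Mapping.keys p. Poly_Mapping.keys \<mu> \<subseteq> V}"

definition mvar :: "'v \<Rightarrow> ('v, 'k::comm_ring_1) mpoly" where
  "mvar v = Poly_Mapping.single (Poly_Mapping.single v 1) 1"

definition monomial_at :: "('v \<Rightarrow> 's::comm_ring_1) \<Rightarrow> ('v \<Rightarrow>\<^sub>0 nat) \<Rightarrow> 's" where
  "monomial_at x \<mu> = (\<Prod>v\<in>Poly_Mapping.keys \<mu>. x v ^ Poly_Mapping.lookup \<mu> v)"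

definition mpoly_at :: "('v \<Rightarrow> 'k alg_closure) \<Rightarrow> ('v, 'k::field) mpoly \<Rightarrow> 'k alg_closure" where
  "mpoly_at x p = (\<Sum>\<mu>\<in>Poly_Mapping.keys p. to_ac (Poly_Mapping.lookup p \<mu>) * monomial_at x \<mu>)"

lemma mpoly_eq_sum_monomials:
  "p = (\<Sum>\<mu>\<in>Poly_Mapping.keys p. Poly_Mapping.single \<mu> (Poly_Mapping.lookup p \<mu>))"
  by (rule poly_mapping_eqI)
    (simp add: lookup_sum lookup_single when_def in_keys_iff sum.delta)

lemma monomial_at_superset:
  assumes "finite K" "Poly_Mapping.keys \<mu> \<subseteq> K"
  shows "monomial_at x \<mu> = (\<Prod>v\<in>K. x v ^ Poly_Mapping.lookup \<mu> v)"
  unfolding monomial_at_def using assms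
  by (intro prod.mono_neutral_left) (auto simp: in_keys_iff)

lemma monomial_at_add: "monomial_at x (\<mu> + \<nu>) = monomial_at x \<mu> * monomial_at x \<nu>"
proof -
  let ?K = "Poly_Mapping.keys \<mu> \<union> Poly_Mapping.keys \<nu>"
  have "Poly_Mapping.keys (\<mu> + \<nu>) \<subseteq> ?K"
    by (rule Poly_Mapping.keys_add)
  then show ?thesis
    by (simp add: monomial_at_superset[of ?K] lookup_add power_add prod.distrib)
qed

lemma mpoly_at_superset:
  assumes "finite K" "Poly_Mapping.keys p \<subseteq> K"
  shows "mpoly_at x p = (\<Sum>\<mu>\<in>K. to_ac (Poly_Mapping.lookup p \<mu>) * monomial_at x \<mu>)"
  unfolding mpoly_at_def using assms
  by (intro sum.mono_neutral_left) (auto simp: in_keys_iff)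

lemma mpoly_at_add: "mpoly_at x (p + q) = mpoly_at x p + mpoly_at x q"
proof -
  let ?K = "Poly_Mapping.keys p \<union> Poly_Mapping.keys q"
  have "Poly_Mapping.keys (p + q) \<subseteq> ?K"
    by (rule Poly_Mapping.keys_add)
  then show ?thesis
    by (simp add: mpoly_at_superset[of ?K] lookup_add distrib_right sum.distrib)
qed

lemma mpoly_at_zero: "mpoly_at x 0 = 0"
  by (simp add: mpoly_at_def)

lemma mpoly_at_single: "mpoly_at x (Poly_Mapping.single \<mu> c) = to_ac c * monomial_at x \<mu>"
  by (simp add: mpoly_at_superset[of "{\<mu>}"])

lemma mpoly_at_sum: "mpoly_at x (sum f J) = (\<Sum>i\<in>J. mpoly_at x (f i))"
  by (induction J rule: infinite_finite_induct) (simp_all add: mpoly_at_add mpoly_at_zero)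

lemma mpoly_at_mult: "mpoly_at x (p * q) = mpoly_at x p * mpoly_at x q"
proof -
  let ?s = "\<lambda>p. \<Sum>\<mu>\<in>Poly_Mapping.keys p. Poly_Mapping.single \<mu> (Poly_Mapping.lookup p \<mu>)"
  have "mpoly_at x (p * q) = mpoly_at x (?s p * ?s q)"
    using mpoly_eq_sum_monomials[of p] mpoly_eq_sum_monomials[of q] by simp
  also have "\<dots> = mpoly_at x (?s p) * mpoly_at x (?s q)"
    by (simp add: sum_product mult_single mpoly_at_sum mpoly_at_single monomial_at_add mult_ac)
  also have "\<dots> = mpoly_at x p * mpoly_at x q"
    using mpoly_eq_sum_monomials[of p] mpoly_eq_sum_monomials[of q] by simp
  finally show ?thesis .
qed

lemma unital_hom_mpoly_at: "unital_hom (mpoly_at x)"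
proof
  show "mpoly_at x 1 = 1"
    by (simp add: mpoly_at_single monomial_at_def flip: single_one)
qed (simp_all add: mpoly_at_add mpoly_at_mult)

lemma mpoly_at_cong:
  assumes "p \<in> mpolys_in V" "\<And>v. v \<in> V \<Longrightarrow> x v = y v"
  shows "mpoly_at x p = mpoly_at y p"
proof -
  have "monomial_at x \<mu> = monomial_at y \<mu>" if "\<mu> \<in> Poly_Mapping.keys p" for \<mu>
  proof -
    have "Poly_Mapping.keys \<mu> \<subseteq> V"
      using assms(1) that by (auto simp: mpolys_in_def)
    then show ?thesis
      using assms(2) by (auto simp: monomial_at_def subset_iff intro!: prod.cong)
  qed
  then show ?thesis by (simp add: mpoly_at_def)
qed

lemma mpolys_in_mono: "V \<subseteq> W \<Longrightarrow> mpolys_in V \<subseteq> mpolys_in W"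
  by (auto simp: mpolys_in_def)

lemma single_mem_mpolys_in: "Poly_Mapping.keys \<mu> \<subseteq> V \<Longrightarrow> Poly_Mapping.single \<mu> c \<in> mpolys_in V"
  by (auto simp: mpolys_in_def)

lemma mvar_mem_mpolys_in: "v \<in> V \<Longrightarrow> mvar v \<in> mpolys_in V"
  unfolding mvar_def by (rule single_mem_mpolys_in) simp

lemma unital_subring_mpolys_in: "unital_subring (mpolys_in V :: ('v, 'k::comm_ring_1) mpoly set)"
proof
  show "(1 :: ('v, 'k) mpoly) \<in> mpolys_in V"
    by (auto simp: mpolys_in_def)
  fix p q :: "('v, 'k) mpoly" assume pq: "p \<in> mpolys_in V" "q \<in> mpolys_in V"
  have "Poly_Mapping.keys (p - q) \<subseteq> Poly_Mapping.keys p \<union> Poly_Mapping.keys q"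
    by (auto simp: in_keys_iff lookup_minus)
  then show "p - q \<in> mpolys_in V"
    using pq by (auto simp: mpolys_in_def)
  show "p * q \<in> mpolys_in V"
    unfolding mpolys_in_def
  proof (intro CollectI ballI)
    fix \<mu> assume "\<mu> \<in> Poly_Mapping.keys (p * q)"
    then obtain \<alpha> \<beta> where ab: "\<alpha> \<in> Poly_Mapping.keys p" "\<beta> \<in> Poly_Mapping.keys q" "\<mu> = \<alpha> + \<beta>"
      using keys_mult[of p q] by blast
    then show "Poly_Mapping.keys \<mu> \<subseteq> V"
      using pq Poly_Mapping.keys_add[of \<alpha> \<beta>] unfolding mpolys_in_def by blast
  qed
qed

text \<open>Collect the powers of \<open>v\<close>: erasing \<open>v\<close> from a monomial gives the coefficient, and the exponent
  of \<open>v\<close> gives the degree.\<close>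

lemma mpolys_in_insert:
  assumes p: "p \<in> mpolys_in (insert v V)"
  shows "\<exists>f\<in>polys_over (mpolys_in V). p = poly f (mvar v)"
proof -
  interpret unital_subring "mpolys_in V :: ('a, 'b) mpoly set"
    by (rule unital_subring_mpolys_in)
  let ?c = "\<lambda>\<mu>. Poly_Mapping.update v 0 \<mu>" and ?n = "\<lambda>\<mu>. Poly_Mapping.lookup \<mu> v"
  let ?f = "\<lambda>\<mu>. monom (Poly_Mapping.single (?c \<mu>) (Poly_Mapping.lookup p \<mu>)) (?n \<mu>)"
  have pow: "mvar v ^ n = Poly_Mapping.single (Poly_Mapping.single v n) (1::'b)" for n
    by (induction n) (simp_all add: mvar_def mult_single flip: single_add)
  \<comment> \<open>\<open>\<mu>\<close> is the product of its \<open>v\<close>-free part and a power of \<open>v\<close>.\<close>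
  have split: "?c \<mu> + Poly_Mapping.single v (?n \<mu>) = \<mu>" for \<mu>
    by (rule poly_mapping_eqI) (simp add: lookup_add lookup_update lookup_single when_def)
  have summand: "poly (?f \<mu>) (mvar v) = Poly_Mapping.single \<mu> (Poly_Mapping.lookup p \<mu>)" for \<mu>
    using split[of \<mu>] by (simp add: poly_monom pow mult_single)
  have "?f \<mu> \<in> polys_over (mpolys_in V)" if "\<mu> \<in> Poly_Mapping.keys p" for \<mu>
    using p that
    by (intro polys_over_monom single_mem_mpolys_in) (auto simp: mpolys_in_def keys_update)
  then have "(\<Sum>\<mu>\<in>Poly_Mapping.keys p. ?f \<mu>) \<in> polys_over (mpolys_in V)"
    by (simp add: polys_over_def coeff_sum sum_mem)
  moreover have "p = poly (\<Sum>\<mu>\<in>Poly_Mapping.keys p. ?f \<mu>) (mvar v)"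
    using mpoly_eq_sum_monomials[of p] by (simp add: poly_sum summand)
  ultimately show ?thesis by blast
qed

text \<open>Changing the coordinate \<open>v\<close> of a point leaves the coefficients alone. This turns an extension of
  the homomorphism \<open>mpoly_at x\<close> into a point.\<close>

lemma mpoly_at_poly_mvar:
  assumes f: "f \<in> polys_over (mpolys_in V)" and v: "v \<notin> V"
  shows "mpoly_at (x(v := \<xi>)) (poly f (mvar v)) = poly (map_poly (mpoly_at x) f) \<xi>"
  using f
proof (induction f)
  case 0
  then show ?case by (simp add: mpoly_at_zero)
next
  case (pCons c f)
  have coeffs: "coeff (pCons c f) i \<in> mpolys_in V" for i
    using pCons.prems by (simp add: polys_over_def)
  have c: "c \<in> mpolys_in V"
    using coeffs[of 0] by simp
  have f: "f \<in> polys_over (mpolys_in V)"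
    using coeffs[of "Suc _"] by (simp add: polys_over_def)
  have "mpoly_at (x(v := \<xi>)) c = mpoly_at x c"
    using v by (intro mpoly_at_cong[OF c]) auto
  moreover have "mpoly_at (x(v := \<xi>)) (mvar v) = \<xi>"
    by (simp add: mvar_def mpoly_at_single monomial_at_def)
  ultimately show ?case
    using pCons.IH[OF f] by (simp del: fun_upd_apply add: mpoly_at_add mpoly_at_mult mpoly_at_zero map_poly_pCons)
qed

text \<open>Induction on the set of variables, with \<open>extend_specialisation\<close> as the step. Allowing any
  \<open>b \<notin> P\<close> makes the induction work: the step replaces \<open>b\<close> by another element outside \<open>P\<close> that
  does not involve the new variable.\<close>

lemma prime_has_zero:
  fixes P :: "('v, 'k::field) mpoly set"
  assumes prime: "prime_on (mpolys_in V) P"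
    and "finite W" "W \<subseteq> V" "b \<in> mpolys_in W" "b \<notin> P"
  shows "\<exists>x. (\<forall>p\<in>P \<inter> mpolys_in W. mpoly_at x p = 0) \<and> mpoly_at x b \<noteq> 0"
  using assms(2-)
proof (induction W arbitrary: b rule: finite_induct)
  case empty
  have ideal: "ideal_on (mpolys_in V) P"
    using prime by (simp add: prime_on_def)
  have const: "\<exists>c. p = Poly_Mapping.single 0 c" if "p \<in> mpolys_in {}" for p :: "('v, 'k) mpoly"
  proof (intro exI poly_mapping_eqI)
    fix \<mu>
    have "Poly_Mapping.lookup p \<mu> = 0" if "\<mu> \<noteq> 0"
      using \<open>p \<in> mpolys_in {}\<close> that by (auto simp: mpolys_in_def in_keys_iff)
    then show "Poly_Mapping.lookup p \<mu> = Poly_Mapping.lookup (Poly_Mapping.single 0 (Poly_Mapping.lookup p 0)) \<mu>"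
      by (auto simp: lookup_single when_def)
  qed
  have "c = 0" if "Poly_Mapping.single 0 c \<in> P" for c :: 'k
  proof (rule ccontr)
    assume "c \<noteq> 0"
    have "Poly_Mapping.single 0 (inverse c) * Poly_Mapping.single 0 c \<in> P"
      using that by (intro ideal_onD(4)[OF ideal] single_mem_mpolys_in) simp_all
    then show False
      using \<open>c \<noteq> 0\<close> prime by (simp add: mult_single prime_on_def)
  qed
  then have "\<forall>p\<in>P \<inter> mpolys_in {}. mpoly_at x p = 0" for x
    using const mpoly_at_zero[of x] by fastforce
  moreover obtain c where "b = Poly_Mapping.single 0 c" "c \<noteq> 0"
    using const[of b] empty.prems ideal_onD(2)[OF ideal] by (metis single_zero)
  ultimately show ?case
    by (simp add: mpoly_at_single monomial_at_def)
next
  case (insert v W)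
  let ?A = "mpolys_in W :: ('v, 'k) mpoly set"
  interpret unital_subring ?A by (rule unital_subring_mpolys_in)
  obtain g where g: "g \<in> polys_over ?A" "b = poly g (mvar v)"
    using mpolys_in_insert[OF insert.prems(2)] by (elim bexE)
  have "?A \<subseteq> mpolys_in V" "mvar v \<in> mpolys_in V"
    using insert.prems(1) by (simp_all add: mpolys_in_mono mvar_mem_mpolys_in)
  from extend_specialisation[OF unital_subring_mpolys_in this prime g(1)] insert.prems(3) g(2)
  obtain a where a: "a \<in> ?A - P"
    and extend: "\<And>\<phi> :: ('v, 'k) mpoly \<Rightarrow> 'k alg_closure.
      unital_hom \<phi> \<Longrightarrow> \<forall>c\<in>?A \<inter> P. \<phi> c = 0 \<Longrightarrow> \<phi> a \<noteq> 0 \<Longrightarrow>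
        \<exists>\<xi>. (\<forall>f\<in>polys_over ?A. poly f (mvar v) \<in> P \<longrightarrow> poly (map_poly \<phi> f) \<xi> = 0) \<and>
             poly (map_poly \<phi> g) \<xi> \<noteq> 0"
    by blast
  obtain x where x: "\<forall>p\<in>P \<inter> ?A. mpoly_at x p = 0" "mpoly_at x a \<noteq> 0"
    using insert.IH[of a] a insert.prems(1) by auto
  obtain \<xi> where \<xi>: "\<And>f. f \<in> polys_over ?A \<Longrightarrow> poly f (mvar v) \<in> P \<Longrightarrow> poly (map_poly (mpoly_at x) f) \<xi> = 0"
      "poly (map_poly (mpoly_at x) g) \<xi> \<noteq> 0"
    using extend[OF unital_hom_mpoly_at[of x]] x by blast
  have "mpoly_at (x(v := \<xi>)) p = 0" if p: "p \<in> P \<inter> mpolys_in (insert v W)" for p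
  proof -
    obtain f where f: "f \<in> polys_over ?A" "p = poly f (mvar v)"
      using mpolys_in_insert[OF IntD2[OF p]] by (elim bexE)
    then show ?thesis
      using \<xi>(1)[of f] p mpoly_at_poly_mvar[OF f(1) insert.hyps(2)] by simp
  qed
  moreover have "mpoly_at (x(v := \<xi>)) b \<noteq> 0"
    using \<xi>(2) mpoly_at_poly_mvar[OF g(1) insert.hyps(2)] g(2) by simp
  ultimately show ?case by blast
qed

theorem nullstellensatz:
  fixes I :: "('v, 'k::field) mpoly set"
  assumes "finite V" and I: "ideal_on (mpolys_in V) I" and p: "p \<in> mpolys_in V"
    and zero: "\<And>x. x \<in> V \<rightarrow>\<^sub>E UNIV \<Longrightarrow> \<forall>q\<in>I. mpoly_at x q = 0 \<Longrightarrow> mpoly_at x p = 0"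
  shows "\<exists>n>0. p ^ n \<in> I"
proof (rule ccontr)
  assume no: "\<not> ?thesis"
  have "p ^ n \<notin> I" for n
  proof
    assume "p ^ n \<in> I"
    then have "p * p ^ n \<in> I"
      using ideal_onD(4)[OF I p] by blast
    then show False using no by (metis power_Suc zero_less_Suc)
  qed
  then obtain P where P: "prime_on (mpolys_in V) P" "I \<subseteq> P" "p \<notin> P"
    using unital_subring.exists_prime_avoiding_powers[OF unital_subring_mpolys_in I p] by blast
  obtain x where x: "\<forall>q\<in>P \<inter> mpolys_in V. mpoly_at x q = 0" "mpoly_at x p \<noteq> 0"
    using prime_has_zero[OF P(1) assms(1) subset_refl p P(3)] by blast
  have restrict: "mpoly_at (restrict x V) q = mpoly_at x q" if "q \<in> mpolys_in V" for q
    using that by (intro mpoly_at_cong) auto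
  have "mpoly_at (restrict x V) p = 0"
    using zero[of "restrict x V"] x(1) P(2) ideal_onD(1)[OF I] restrict by (auto simp: subset_iff)
  then show False
    using x(2) restrict[OF p] by simp
qed

section \<open>Surface points and triple points near a true vertex\<close>

text \<open>Charts compose with homeomorphisms onto open subsets of the model. Hence the local type of a
  point near a true vertex can be read off inside the cone.\<close>

lemma modelled_on_image:
  fixes Q :: "'b::topological_space set" and Q' :: "'c::topological_space set"
  assumes k: "embedding_map (top_of_set Q) P k" "openin P (k ` Q)"
    and f: "homeomorphism Q' U f g" and U: "openin (top_of_set Q) U" and p: "p \<in> D \<inter> Q'"
  shows "modelled_on P Q' D (k (f p))"
proof -
  have fU: "f ` Q' = U" and "U \<subseteq> Q"
    using f openin_imp_subset[OF U] by (auto simp: homeomorphism_def)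
  have "homeomorphic_map (top_of_set Q') (top_of_set U) f"
    using f by (auto simp: homeomorphic_map_maps homeomorphic_maps_def homeomorphism_def)
  then have "embedding_map (top_of_set Q') (top_of_set Q) f"
    using fU \<open>U \<subseteq> Q\<close> by (simp add: embedding_map_def subtopology_subtopology inf_absorb2)
  then have "embedding_map (top_of_set Q') P (k \<circ> f)"
    using k(1) by (rule embedding_map_compose)
  moreover have "open_map (top_of_set Q) P k"
    using k homeomorphic_imp_open_map open_map_from_open_subtopology
    unfolding embedding_map_def by fastforce
  then have "openin P ((k \<circ> f) ` Q')"
    using U fU by (metis image_comp open_map_def)
  ultimately show ?thesis
    using p unfolding modelled_on_def by fastforce
qed

text \<open>The cone consists of the six faces, one for each pair of coordinates.\<close>

lemma cone_K4_eq: "cone_K4 = {axis i a + axis j b | i j a b. 0 \<le> a \<and> 0 \<le> b \<and> a + b < 1}"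
proof (intro subset_antisym subsetI)
  fix v assume "v \<in> cone_K4"
  then obtain t x i j where v: "v = t *\<^sub>R x" "0 \<le> t" "t < 1"
      "x \<in> closed_segment (axis i 1) (axis j (1::real))"
    unfolding cone_K4_def K4_def by blast
  then obtain u where u: "0 \<le> u" "u \<le> 1" "x = (1 - u) *\<^sub>R axis i 1 + u *\<^sub>R axis j (1::real)"
    by (auto simp: in_segment)
  have "v = axis i (t * (1 - u)) + axis j (t * u)"
    by (simp add: v(1) u(3) vec_eq_iff axis_def algebra_simps)
  moreover have "t * (1 - u) + t * u < 1"
    using v(3) by (simp add: algebra_simps)
  moreover have "0 \<le> t * (1 - u)" "0 \<le> t * u"
    using v(2) u by auto
  ultimately show "v \<in> {axis i a + axis j b | i j a b. 0 \<le> a \<and> 0 \<le> b \<and> a + b < 1}"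
    by blast
next
  fix v :: "real^4" assume "v \<in> {axis i a + axis j b | i j a b. 0 \<le> a \<and> 0 \<le> b \<and> a + b < 1}"
  then obtain i j a b where v: "v = axis i a + axis j b" "0 \<le> a" "0 \<le> b" "a + b < 1"
    by blast
  define x :: "real^4" where "x = (1 - b / (a + b)) *\<^sub>R axis i 1 + (b / (a + b)) *\<^sub>R axis j 1"
  have "0 \<le> b / (a + b)" "b / (a + b) \<le> 1"
    using v by (auto simp: divide_le_eq_1)
  then have "x \<in> closed_segment (axis i 1) (axis j 1)"
    unfolding in_segment x_def by blast
  then have "x \<in> K4"
    unfolding K4_def by blast
  moreover have "v = (a + b) *\<^sub>R x"
  proof (cases "a + b = 0")
    case True
    then have "a = 0" "b = 0" using v by auto
    then show ?thesis by (simp add: v(1) vec_eq_iff axis_def)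
  next
    case False
    then have "(a + b) * (1 - b / (a + b)) = a" "(a + b) * (b / (a + b)) = b"
      by (simp_all add: right_diff_distrib)
    then have "(a + b) *\<^sub>R x = a *\<^sub>R axis i 1 + b *\<^sub>R axis j 1"
      by (simp only: x_def scaleR_add_right scaleR_scaleR)
    then show ?thesis
      by (simp add: v(1) vec_eq_iff axis_def)
  qed
  ultimately show "v \<in> cone_K4"
    using v unfolding cone_K4_def by (intro CollectI exI[of _ "a + b"] exI[of _ x]) auto
qed

lemma axis_add_axis_mem_cone_K4:
  "0 \<le> a \<Longrightarrow> 0 \<le> b \<Longrightarrow> a + b < 1 \<Longrightarrow> axis i a + axis j b \<in> cone_K4"
  unfolding cone_K4_eq by blast

lemma sum_axis [simp]: "(\<Sum>l\<in>UNIV. axis i (a::real) $ l) = a"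
  by (simp add: axis_def)

lemma cone_K4_eq_on_face:
  assumes v: "v \<in> cone_K4" and "v $ i \<noteq> 0" "v $ j \<noteq> 0" "i \<noteq> j"
  shows "v = axis i (v $ i) + axis j (v $ j)"
proof -
  obtain i' j' a b where ab: "v = axis i' a + axis j' b"
    using v unfolding cone_K4_eq by blast
  then have "v $ l = 0" if "l \<noteq> i'" "l \<noteq> j'" for l
    using that by (simp add: axis_def)
  then have "i = i' \<and> j = j' \<or> i = j' \<and> j = i'"
    using assms(2-4) by metis
  then show ?thesis
    using \<open>i \<noteq> j\<close> ab by (auto simp: vec_eq_iff axis_def)
qed

text \<open>The small disc \<open>f ` open_disc\<close> around the base point stays in the interior of the face spanned by
  the coordinates \<open>i\<close> and \<open>j\<close>. No other face meets the set where both of these coordinates are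
  positive, so the disc is open in the cone.\<close>

lemma sector_is_surface_point:
  assumes k: "embedding_map (top_of_set cone_K4) P k" "openin P (k ` cone_K4)" and "i \<noteq> j"
  shows "sector k i j (Complex (1/4) (1/4)) \<in> surface_points P"
proof -
  define f :: "complex \<Rightarrow> real^4" where
    "f z = (1/4 + Im z / 8) *\<^sub>R axis i 1 + (1/4 + Re z / 8) *\<^sub>R axis j 1" for z
  define g :: "real^4 \<Rightarrow> complex" where
    "g v = Complex (8 * (v $ j - 1/4)) (8 * (v $ i - 1/4))" for v
  let ?U = "cone_K4 \<inter> g -` open_disc"
  have g_alt: "g = (\<lambda>v. of_real (8 * (v $ j - 1/4)) + \<i> * of_real (8 * (v $ i - 1/4)))"
    by (auto simp: g_def complex_eq_iff)
  have cont: "continuous_on S g" for S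
    unfolding g_alt by (intro continuous_intros)
  have f_axis: "f z = axis i (1/4 + Im z / 8) + axis j (1/4 + Re z / 8)" for z
    by (simp add: f_def vec_eq_iff axis_def)
  have gf: "g (f z) = z" for z
    using \<open>i \<noteq> j\<close> by (simp add: g_def f_axis axis_def complex_eq_iff)
  have "f z \<in> cone_K4" if "z \<in> open_disc" for z
    unfolding f_axis
    using that abs_Re_le_cmod[of z] abs_Im_le_cmod[of z] by (intro axis_add_axis_mem_cone_K4) auto
  then have f_mem: "f z \<in> ?U" if "z \<in> open_disc" for z
    using that gf by auto
  have fg: "f (g v) = v" if "v \<in> ?U" for v
  proof -
    have "norm (g v) < 1" using that by simp
    then have "\<bar>8 * (v $ i - 1/4)\<bar> < 1" "\<bar>8 * (v $ j - 1/4)\<bar> < 1"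
      using abs_Re_le_cmod[of "g v"] abs_Im_le_cmod[of "g v"] by (auto simp: g_def)
    then have "v $ i \<noteq> 0" "v $ j \<noteq> 0" by auto
    then have "v = axis i (v $ i) + axis j (v $ j)"
      using that \<open>i \<noteq> j\<close> by (intro cone_K4_eq_on_face) auto
    moreover have "1/4 + 8 * (t - 1/4) / 8 = t" for t :: real
      by (simp add: field_simps)
    ultimately show ?thesis
      by (simp only: f_axis g_def complex.sel)
  qed
  have "homeomorphism open_disc ?U f g"
  proof (rule homeomorphismI)
    show "continuous_on open_disc f"
      unfolding f_def by (intro continuous_intros) auto
  qed (use f_mem fg gf cont in auto)
  moreover have "openin (top_of_set cone_K4) ?U"
    using open_vimage[OF open_ball cont] by (intro openin_open_Int) auto
  ultimately have "modelled_on P open_disc {0} (k (f 0))"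
    by (rule modelled_on_image[OF k]) simp
  then show ?thesis
    by (simp add: surface_points_def sector_def f_axis)
qed

text \<open>The part of the cone where coordinate \<open>i\<close> is positive consists of the three faces through the
  ray \<open>i\<close>, glued along it. The map \<open>v \<mapsto> v / (1 - sum v)\<close> stretches the cone
  over \<open>K4\<close> to the infinite cone. There, the logarithm of coordinate \<open>i\<close> parametrises the line and
  the other three coordinates parametrise the tripod. The chart \<open>f\<close> is the inverse of this map.\<close>

lemma germ_is_triple_point:
  assumes k: "embedding_map (top_of_set cone_K4) P k" "openin P (k ` cone_K4)"
  shows "k (axis i (1/2)) \<in> triple_points P"
proof -
  \<comment> \<open>The legs of the tripod are matched with the three coordinates other than \<open>i\<close>.\<close>
  have "card (UNIV :: 3 set) = card (UNIV - {i})"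
    by (simp add: card_Diff_singleton)
  then obtain \<sigma> :: "3 \<Rightarrow> 4" where \<sigma>: "bij_betw \<sigma> UNIV (UNIV - {i})"
    using finite_same_card_bij[of "UNIV :: 3 set" "UNIV - {i}"] by auto
  then have \<sigma>i: "\<sigma> l \<noteq> i" "i \<noteq> \<sigma> l" and inj: "\<sigma> l = \<sigma> l' \<longleftrightarrow> l = l'" for l l'
    by (auto simp: bij_betw_def inj_on_def)
  have surj: "\<exists>l. j = \<sigma> l" if "j \<noteq> i" for j
    using \<sigma> that by (metis DiffI UNIV_I bij_betw_imp_surj_on imageE singletonD)
  define f :: "real \<times> (real^3) \<Rightarrow> real^4" where
    "f = (\<lambda>(s, a). (1 / (1 + exp s + (\<Sum>l\<in>UNIV. a $ l))) *\<^sub>R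
            (exp s *\<^sub>R axis i 1 + (\<Sum>l\<in>UNIV. (a $ l) *\<^sub>R axis (\<sigma> l) 1)))"
  define g :: "real^4 \<Rightarrow> real \<times> (real^3)" where
    "g v = (ln (v $ i / (1 - (\<Sum>l\<in>UNIV. v $ l))), \<chi> l. v $ \<sigma> l / (1 - (\<Sum>l\<in>UNIV. v $ l)))" for v
  let ?Q = "(UNIV :: real set) \<times> tripod" and ?U = "cone_K4 \<inter> {v. 0 < v $ i}"
  have f_axis: "f (s, axis l t) = axis i (exp s / (1 + exp s + t)) + axis (\<sigma> l) (t / (1 + exp s + t))"
    for s l t
  proof -
    have "(\<Sum>l'\<in>UNIV. (axis l t $ l') *\<^sub>R axis (\<sigma> l') 1) = (\<Sum>l'\<in>UNIV. if l' = l then axis (\<sigma> l) t else 0)"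
      by (intro sum.cong) (auto simp: axis_def vec_eq_iff)
    also have "\<dots> = axis (\<sigma> l) t"
      by simp
    finally show ?thesis
      by (simp add: f_def vec_eq_iff) (simp add: axis_def add_divide_distrib)
  qed
  have g_axis: "g (axis i x + axis (\<sigma> l) y) = (ln (x / (1 - x - y)), axis l (y / (1 - x - y)))"
    for x y l
    using \<sigma>i inj by (auto simp: g_def vec_eq_iff sum.distrib diff_diff_eq axis_def)
  have tripodE: "\<exists>l t. a = axis l t \<and> 0 \<le> t" if "a \<in> tripod" for a
    using that by (auto simp: tripod_def)
  have U: "\<exists>x y l. v = axis i x + axis (\<sigma> l) y \<and> 0 < x \<and> 0 \<le> y \<and> x + y < 1" if vU: "v \<in> ?U" for v
  proof -
    obtain i' j' a b where v: "v = axis i' a + axis j' b" "0 \<le> a" "0 \<le> b" "a + b < 1"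
      using vU unfolding cone_K4_eq by blast
    have pos: "0 < v $ i" using vU by simp
    consider "i' = i" "j' = i" | "i' = i" "j' \<noteq> i" | "i' \<noteq> i" "j' = i"
      using v(1) pos by (fastforce simp: axis_def)
    then show ?thesis
    proof cases
      case 1
      \<comment> \<open>A point of the ray itself lies on all three faces, so the choice of leg is immaterial.\<close>
      have "v = axis i (a + b) + axis (\<sigma> 0) 0"
        by (simp add: v(1) 1 vec_eq_iff axis_def)
      moreover have "0 < a + b"
        using pos by (simp add: v(1) 1 axis_def)
      ultimately show ?thesis
        using v(4) by (intro exI[of _ "a + b"] exI[of _ 0] exI[of _ "0::3"]) auto
    next
      case 2
      obtain l where "j' = \<sigma> l" using surj 2 by blast
      moreover have "0 < a"
        using pos 2 by (simp add: v(1) axis_def)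
      ultimately show ?thesis
        using v 2 by blast
    next
      case 3
      obtain l where "i' = \<sigma> l" using surj 3 by blast
      moreover have "0 < b"
        using pos 3 by (simp add: v(1) axis_def)
      moreover have "v = axis i b + axis i' a"
        by (simp add: v(1) 3 add.commute)
      ultimately show ?thesis
        using v 3 by (metis add.commute)
    qed
  qed
  have "homeomorphism ?Q ?U f g"
  proof (rule homeomorphismI)
    have "1 + exp s + (\<Sum>l\<in>UNIV. a $ l) \<noteq> 0" if a: "a \<in> tripod" for s :: real and a
    proof -
      obtain l t where "a = axis l t" "0 \<le> t"
        using tripodE[OF a] by blast
      then show ?thesis
        using exp_gt_zero[of s] by (simp del: exp_gt_zero)
    qed
    then show "continuous_on ?Q f"
      unfolding f_def case_prod_beta by (intro continuous_intros) auto
    have "0 < v $ i" "0 < 1 - (\<Sum>l\<in>UNIV. v $ l)" if "v \<in> ?U" for v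
      using U[OF that] that by (auto simp: sum.distrib)
    then show "continuous_on ?U g"
      unfolding g_def by (intro continuous_intros) (force simp: divide_eq_0_iff)+
    show "f ` ?Q \<subseteq> ?U"
    proof clarify
      fix s a assume "a \<in> tripod"
      then obtain l t where a: "a = axis l t" "0 \<le> t"
        using tripodE by blast
      have "exp s / (1 + exp s + t) + t / (1 + exp s + t) < 1"
        using a by (simp add: add_divide_distrib[symmetric] add_pos_nonneg)
      then show "f (s, a) \<in> ?U"
        using \<sigma>i a unfolding a f_axis
        by (intro IntI axis_add_axis_mem_cone_K4) (auto simp: axis_def add_pos_nonneg)
    qed
    show "g ` ?U \<subseteq> ?Q"
    proof (intro image_subsetI)
      fix v assume "v \<in> ?U"
      then obtain x y l where v: "v = axis i x + axis (\<sigma> l) y" "0 \<le> y" "x + y < 1"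
        using U by blast
      then have "0 \<le> y / (1 - x - y)" by simp
      then show "g v \<in> ?Q"
        by (auto simp: v(1) g_axis tripod_def)
    qed
    show "g (f p) = p" if p: "p \<in> ?Q" for p
    proof -
      obtain s l t where p: "p = (s, axis l t)" "0 \<le> t"
        using p tripodE by (cases p) blast
      have pos: "0 < 1 + exp s + t"
        using p(2) by (simp add: add_pos_nonneg)
      then have "1 - exp s / (1 + exp s + t) - t / (1 + exp s + t) = 1 / (1 + exp s + t)"
        by (simp add: field_simps)
      then show ?thesis
        using pos by (simp add: p(1) f_axis g_axis)
    qed
    show "f (g v) = v" if v: "v \<in> ?U" for v
    proof -
      obtain x y l where v: "v = axis i x + axis (\<sigma> l) y" "0 < x" "0 \<le> y" "x + y < 1"
        using U[OF v] by blast
      let ?d = "1 - x - y"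
      have d: "0 < ?d" using v by simp
      have "1 + x / ?d + y / ?d = 1 / ?d"
        using d by (simp add: field_simps)
      moreover have "exp (ln (x / ?d)) = x / ?d"
        using v d by simp
      ultimately show ?thesis
        using d by (simp add: v(1) g_axis f_axis)
    qed
  qed
  moreover have "openin (top_of_set cone_K4) ?U"
    by (intro openin_open_Int open_Collect_less continuous_intros)
  moreover have "(0, 0) \<in> (UNIV \<times> {0}) \<inter> ?Q"
    by (auto simp: tripod_def axis_def vec_eq_iff intro!: exI[of _ 0])
  ultimately have "modelled_on P ?Q (UNIV \<times> {0}) (k (f (0, 0)))"
    by (rule modelled_on_image[OF k])
  moreover have "f (0, 0) = axis i (1/2)"
    by (simp add: f_def vec_eq_iff axis_def)
  ultimately show ?thesis
    by (simp add: triple_points_def)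
qed

lemma sector_stratum_mem_strata:
  assumes k: "embedding_map (top_of_set cone_K4) P k" "openin P (k ` cone_K4)" and "i \<noteq> j"
  shows "sector_stratum P k i j \<in> strata P"
proof -
  have "axis i (1/4) + axis j (1/4) \<in> cone_K4"
    by (rule axis_add_axis_mem_cone_K4) auto
  then have "sector k i j (Complex (1/4) (1/4)) \<in> topspace P"
    using openin_subset[OF k(2)] by (auto simp: sector_def)
  then show ?thesis
    using sector_is_surface_point[OF assms]
    by (simp add: sector_stratum_def strata_def connected_components_of_def)
qed

lemma germ_edge_mem_true_edges:
  assumes k: "embedding_map (top_of_set cone_K4) P k" "openin P (k ` cone_K4)"
  shows "germ_edge P k i \<in> true_edges P"
proof -
  have "axis i (1/2) + axis i 0 \<in> cone_K4"
    by (rule axis_add_axis_mem_cone_K4) auto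
  moreover have "axis i (1/2) + axis i 0 = (axis i (1/2) :: real^4)"
    by (simp add: vec_eq_iff axis_def)
  ultimately have "k (axis i (1/2)) \<in> topspace P"
    using openin_subset[OF k(2)] by auto
  then show ?thesis
    using germ_is_triple_point[OF assms]
    by (simp add: germ_edge_def true_edges_def connected_components_of_def)
qed

section \<open>The state sum lies in the polynomial ring\<close>

lemma carrier_tv_ring: "carrier (tv_ring F G neg) = mpolys_in (tv_vars F G neg)"
  by (simp add: tv_ring_def mpolys_in_def)

lemma eval_poly_eq_mpoly_at: "eval_poly p x = mpoly_at x p"
  by (simp add: eval_poly_def mpoly_at_def monomial_at_def)

lemma finite_tv_vars:
  assumes "finite F" "finite G"
  shows "finite (tv_vars F G neg)"
proof -
  let ?J = "\<lambda>((a, b, c, f, e, d), (A, B, C, D)). SixJ a b c f e d A B C D"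
  have "symbols_over F G \<subseteq> Weight ` F \<union> ?J ` ((F \<times> F \<times> F \<times> F \<times> F \<times> F) \<times> (G \<times> G \<times> G \<times> G))"
  proof
    fix s assume "s \<in> symbols_over F G"
    then show "s \<in> Weight ` F \<union> ?J ` ((F \<times> F \<times> F \<times> F \<times> F \<times> F) \<times> (G \<times> G \<times> G \<times> G))"
      by (cases s) (force simp: symbols_over_def image_iff)+
  qed
  then have "finite (symbols_over F G)"
    using assms by (elim finite_subset) simp
  then show ?thesis
    by (simp add: tv_vars_def quotient_def)
qed

lemma tv_sym_mem:
  assumes "s \<in> symbols_over F G"
  shows "tv_sym F G neg s \<in> mpolys_in (tv_vars F G neg)"
  unfolding tv_sym_def
  using assms by (intro single_mem_mpolys_in) (simp add: tv_vars_def quotientI)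

lemma tv_relation_mem:
  assumes neg: "\<And>f. f \<in> F \<Longrightarrow> neg f \<in> F"
    and jk: "\<forall>i\<in>{1..9}. j i \<in> F" "\<forall>i\<in>{1..6}. k i \<in> G"
  shows "tv_relation F G neg j k \<in> mpolys_in (tv_vars F G neg)"
proof -
  interpret unital_subring "mpolys_in (tv_vars F G neg)"
    by (rule unital_subring_mpolys_in)
  have "j 1 \<in> F" "j 2 \<in> F" "j 3 \<in> F" "j 4 \<in> F" "j 5 \<in> F" "j 6 \<in> F" "j 7 \<in> F" "j 8 \<in> F" "j 9 \<in> F"
    and "k 1 \<in> G" "k 2 \<in> G" "k 3 \<in> G" "k 4 \<in> G" "k 5 \<in> G" "k 6 \<in> G"
    using jk by auto
  then show ?thesis
    unfolding tv_relation_def Let_def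
    by (intro diff_mem sum_mem mult_mem tv_sym_mem) (simp_all add: symbols_over_def neg)
qed

text \<open>Colours outside the strata and the true edges are arbitrary, so this depends on the sectors
  and germs at a vertex belonging to actual strata and true edges.\<close>

lemma vertex_symbol_mem:
  assumes neg: "\<And>f. f \<in> F \<Longrightarrow> neg f \<in> F"
    and k: "embedding_map (top_of_set cone_K4) P k" "openin P (k ` cone_K4)"
    and col: "\<phi> \<in> strata P \<rightarrow> F" "\<psi> \<in> true_edges P \<rightarrow> G"
  shows "vertex_symbol neg P h k \<phi> \<psi> \<in> symbols_over F G"
proof -
  have "sector_colour neg P h k \<phi> i j \<in> F" if "i \<noteq> j" for i j
    using sector_stratum_mem_strata[OF k that] col(1) neg by (auto simp: sector_colour_def Let_def)
  moreover have "\<psi> (germ_edge P k i) \<in> G" for i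
    using germ_edge_mem_true_edges[OF k] col(2) by blast
  ultimately show ?thesis
    by (simp add: vertex_symbol_def symbols_over_def Let_def)
qed

lemma state_sum_mem:
  assumes neg: "\<And>f. f \<in> F \<Longrightarrow> neg f \<in> F" and S: "S \<in> marked_spines M"
  shows "state_sum F G neg M S \<in> mpolys_in (tv_vars F G neg)"
proof -
  interpret unital_subring "mpolys_in (tv_vars F G neg)"
    by (rule unital_subring_mpolys_in)
  let ?P = "subtopology M (spine S)"
  have label: "embedding_map (top_of_set cone_K4) ?P (label S v)" "openin ?P (label S v ` cone_K4)"
    if "v \<in> true_vertices ?P" for v
    using S that by (auto simp: marked_spines_def germ_labelling_def)
  show ?thesis
    unfolding state_sum_def Let_def
  proof (intro sum_mem, clarify)
    fix \<phi> \<psi> assume "(\<phi>, \<psi>) \<in> colourings F G ?P"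
    then have col: "\<phi> \<in> strata ?P \<rightarrow> F" "\<psi> \<in> true_edges ?P \<rightarrow> G"
      by (auto simp: colourings_def)
    then have "Weight (\<phi> C) \<in> symbols_over F G" if "C \<in> strata ?P" for C
      using that by (auto simp: symbols_over_def)
    then show "(\<Prod>C\<in>strata ?P. tv_sym F G neg (Weight (\<phi> C))) *
        (\<Prod>v\<in>true_vertices ?P. tv_sym F G neg (vertex_symbol neg ?P (orient S) (label S v) \<phi> \<psi>))
        \<in> mpolys_in (tv_vars F G neg)"
      by (intro mult_mem prod_mem tv_sym_mem vertex_symbol_mem neg label col)
  qed
qed

section \<open>Numerical invariants and the radical\<close>

lemma cring_tv_ring: "cring (tv_ring F G neg :: ('f, 'g, 'k::field) tv_poly ring)"
proof -
  interpret unital_subring "mpolys_in (tv_vars F G neg) :: ('f, 'g, 'k) tv_poly set"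
    by (rule unital_subring_mpolys_in)
  have carrier: "carrier (tv_ring F G neg :: ('f, 'g, 'k) tv_poly ring) = mpolys_in (tv_vars F G neg)"
    by (rule carrier_tv_ring)
  show ?thesis
  proof (intro cringI abelian_groupI comm_monoidI)
    fix p :: "('f, 'g, 'k) tv_poly" assume "p \<in> carrier (tv_ring F G neg)"
    then have "- p \<in> carrier (tv_ring F G neg)"
      using diff_mem[OF zero_mem, of p] by (simp add: carrier)
    then show "\<exists>q\<in>carrier (tv_ring F G neg). q \<oplus>\<^bsub>tv_ring F G neg\<^esub> p = \<zero>\<^bsub>tv_ring F G neg\<^esub>"
      by (intro bexI[of _ "- p"]) (simp_all add: tv_ring_def)
  qed (unfold carrier, simp_all add: tv_ring_def zero_mem one_mem add_mem mult_mem algebra_simps)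
qed

lemma tv_ring_power: "p [^]\<^bsub>tv_ring F G neg\<^esub> (n::nat) = p ^ n"
  by (induction n) (simp_all add: nat_pow_def tv_ring_def mult.commute)

lemma ideal_on_tv_ideal:
  assumes "\<And>f. f \<in> F \<Longrightarrow> neg f \<in> F"
  shows "ideal_on (mpolys_in (tv_vars F G neg)) (tv_ideal F G neg :: ('f, 'g, 'k::field) tv_poly set)"
proof -
  let ?R = "tv_ring F G neg :: ('f, 'g, 'k) tv_poly ring"
  interpret cring ?R by (rule cring_tv_ring)
  have "{tv_relation F G neg j k | j k. (\<forall>i\<in>{1..9}. j i \<in> F) \<and> (\<forall>i\<in>{1..6}. k i \<in> G)} \<subseteq> carrier ?R"
    using tv_relation_mem[OF assms] by (auto simp: carrier_tv_ring)
  then have "ideal (tv_ideal F G neg) ?R"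
    unfolding tv_ideal_def by (rule genideal_ideal)
  then interpret ideal "tv_ideal F G neg" ?R .
  show ?thesis
    unfolding ideal_on_def
    using a_subset zero_closed a_closed I_l_closed by (auto simp: tv_ring_def mpolys_in_def)
qed

text \<open>The Nullstellensatz for the Turaev--Viro ideal. Read from right to left, it also shows at once
  that the radical is closed under addition.\<close>

lemma radical_tv_ideal:
  assumes "finite F" "finite G" "\<And>f. f \<in> F \<Longrightarrow> neg f \<in> F"
  shows "p \<in> radical (tv_ring F G neg) (tv_ideal F G neg) \<longleftrightarrow>
    p \<in> mpolys_in (tv_vars F G neg) \<and> (\<forall>x\<in>tv_variety F G neg. eval_poly p x = 0)"
proof -
  have "eval_poly p x = 0" if "p ^ n \<in> tv_ideal F G neg" "x \<in> tv_variety F G neg" for n x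
  proof -
    have "mpoly_at x (p ^ n) = 0"
      using that by (auto simp: tv_variety_def eval_poly_eq_mpoly_at)
    then show ?thesis
      by (simp add: unital_hom.hom_power[OF unital_hom_mpoly_at] eval_poly_eq_mpoly_at)
  qed
  moreover have "\<exists>n>0. p ^ n \<in> tv_ideal F G neg"
    if "p \<in> mpolys_in (tv_vars F G neg)" "\<forall>x\<in>tv_variety F G neg. eval_poly p x = 0"
    using that
    by (intro nullstellensatz[OF finite_tv_vars[OF assms(1,2)] ideal_on_tv_ideal[OF assms(3)]])
      (auto simp: tv_variety_def eval_poly_eq_mpoly_at)
  ultimately show ?thesis
    by (auto simp: radical_def carrier_tv_ring tv_ring_power)
qed

theorem theorem3:
  fixes F :: "'f set" and G :: "'g set" and neg :: "'f \<Rightarrow> 'f" and m n :: nat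
    and M1 :: "'a topology" and M2 :: "'b topology"
    and S1 :: "'a marked_spine" and S2 :: "'b marked_spine"
  assumes "finite F" "card F = m" "finite G" "card G = n"
    and "\<And>f. f \<in> F \<Longrightarrow> neg f \<in> F" "\<And>f. f \<in> F \<Longrightarrow> neg (neg f) = f"
    and "compact_3_manifold M1" "S1 \<in> marked_spines M1"
    and "compact_3_manifold M2" "S2 \<in> marked_spines M2"
  shows "(universal_tv F G neg M1 S1 :: ('f, 'g, 'k::field) tv_poly set) = universal_tv F G neg M2 S2 \<longleftrightarrow>
    (\<forall>x\<in>(tv_variety F G neg :: (('f, 'g) tv_var \<Rightarrow> 'k alg_closure) set).
       numerical_tv F G neg x M1 S1 = numerical_tv F G neg x M2 S2)"
proof -
  let ?C = "mpolys_in (tv_vars F G neg) :: ('f, 'g, 'k) tv_poly set"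
  define J :: "('f, 'g, 'k) tv_poly set" where "J = radical (tv_ring F G neg) (tv_ideal F G neg)"
  define p1 p2 :: "('f, 'g, 'k) tv_poly"
    where "p1 = state_sum F G neg M1 S1" and "p2 = state_sum F G neg M2 S2"
  interpret unital_subring ?C by (rule unital_subring_mpolys_in)
  have p: "p1 \<in> ?C" "p2 \<in> ?C"
    unfolding p1_def p2_def using assms by (auto intro: state_sum_mem)
  have J: "q \<in> J \<longleftrightarrow> q \<in> ?C \<and> (\<forall>x\<in>tv_variety F G neg. mpoly_at x q = 0)" for q
    using radical_tv_ideal[OF assms(1,3,5)] by (simp add: J_def eval_poly_eq_mpoly_at)
  have coset: "J +>\<^bsub>tv_ring F G neg\<^esub> q = {h + q | h. h \<in> J}" for q
    by (auto simp: a_r_coset_def' tv_ring_def)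
  have at_diff: "mpoly_at x (q - r) = mpoly_at x q - mpoly_at x r" for x q and r :: "('f, 'g, 'k) tv_poly"
    by (rule unital_hom.hom_diff[OF unital_hom_mpoly_at])
  have "0 \<in> J"
    by (simp add: J zero_mem mpoly_at_zero)
  have coset_mono: "{h + q | h. h \<in> J} \<subseteq> {h + r | h. h \<in> J}" if qr: "q - r \<in> J" for q r
  proof clarify
    fix h assume "h \<in> J"
    then have "h + (q - r) \<in> J"
      using qr by (simp add: J mpoly_at_add add_mem)
    moreover have "h + q = (h + (q - r)) + r"
      by simp
    ultimately show "\<exists>h'. h + q = h' + r \<and> h' \<in> J"
      by blast
  qed
  have "{h + p1 | h. h \<in> J} = {h + p2 | h. h \<in> J} \<longleftrightarrow> p1 - p2 \<in> J"
  proof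
    assume "{h + p1 | h. h \<in> J} = {h + p2 | h. h \<in> J}"
    moreover have "p1 \<in> {h + p1 | h. h \<in> J}"
      using \<open>0 \<in> J\<close> by force
    ultimately show "p1 - p2 \<in> J" by auto
  next
    assume "p1 - p2 \<in> J"
    moreover from this have "p2 - p1 \<in> J"
      using p by (simp add: J at_diff diff_mem)
    ultimately show "{h + p1 | h. h \<in> J} = {h + p2 | h. h \<in> J}"
      by (intro subset_antisym coset_mono)
  qed
  also have "\<dots> \<longleftrightarrow> (\<forall>x\<in>tv_variety F G neg. mpoly_at x p1 = mpoly_at x p2)"
    using p by (simp add: J at_diff diff_mem)
  finally show ?thesis
    by (simp add: universal_tv_def numerical_tv_def coset p1_def p2_def eval_poly_eq_mpoly_at
        flip: J_def)
qed

end
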